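(* Let $X$ and $Y$ be objects of an $R$-linear triangulated category $\mathsf{T}$ with $\operatorname{Hom}^*_{\mathsf{T}}(X,Y)$ in $\mathsf{noeth}^{\mathsf{fl}}(R)$. Let $s=\operatorname{cx}(X,Y)$ and assume $e^s(X,Y)=0$. Then there exists an integer $m_0$ with the following property: if $\lambda^n(X,Y)=0$ for $d/2$ consecutive even values of $n\ge m_0$, or for $d/2$ consecutive odd values of $n\ge m_0$, then $\lambda^n(X,Y)=0$ for all $n\ge m_0$.
   Context: $R=\bigoplus_{n\ge 0}R^n$ is a graded-commutative Noetherian ring, generated over $R^0$ by $R^d$ for a fixed even integer $d\ge 2$ (standing assumption). $\mathsf{T}$ is a triangulated category with suspension $\Sigma$ which is $R$-linear: there is a graded ring homomorphism from $R$ to the graded center of $\mathsf{T}$ (degree-$n$ elements are natural transformations $\eta:\mathrm{id}\to\Sigma^n$ with $\eta\Sigma=(-1)^n\Sigma\eta$), making $\operatorname{Hom}^*_{\mathsf{T}}(X,Y)=\bigoplus_{n\in\mathbb{Z}}\operatorname{Hom}_{\mathsf{T}}(X,\Sigma^nY)$ a graded $R$-module. Set $\lambda^n(X,Y)=\ell_{R^0}\operatorname{Hom}_{\mathsf{T}}(X,\Sigma^nY)$. $\operatorname{Hom}^*_{\mathsf{T}}(X,Y)\in\mathsf{noeth}^{\mathsf{fl}}(R)$ means $\bigoplus_{n\ge n_0}\operatorname{Hom}_{\mathsf{T}}(X,\Sigma^nY)$ is Noetherian over $R$ for some $n_0$ and all $\lambda^n(X,Y)<\infty$. Hilbert polynomials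 $g_i\in\mathbb{Q}[t]$ satisfy $g_i(n)=\lambda^{dn+i}(X,Y)$ for $n\gg0$, $i=0,\dots,d-1$; $\operatorname{cx}(X,Y)=1+\max_i\deg g_i$ (zero polynomial has degree $-1$). $h(X,Y)(n)=\sum_{i=0}^{d-1}(-1)^{n+i}\lambda^{n+i}(X,Y)$; $\Delta^1f(n)=f(n+d)-f(n)$, $\Delta^0f=f$, $\Delta^sf=\Delta^1(\Delta^{s-1}f)$. For $s\ge\operatorname{cx}(X,Y)$: if $\operatorname{cx}(X,Y)\ge1$, $e^s(X,Y)=\Delta^{s-1}h(X,Y)(n)$ for $n\gg0$; if $\operatorname{cx}(X,Y)=0$ and $\lambda^n(X,Y)=0$ for $n\ll0$, $e^0(X,Y)=\sum_n(-1)^n\lambda^n(X,Y)$. *)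

theory Defs
  imports "HOL-Computational_Algebra.Polynomial"
begin

text \<open>Morphisms form a type 'm with domain/codomain maps; Comp g f is g after f.
  The suspension is an automorphism (SigO on objects, SigM on morphisms).\<close>

record ('o,'m) tcat =
  Dom :: "'m \<Rightarrow> 'o"
  Cod :: "'m \<Rightarrow> 'o"
  Comp :: "'m \<Rightarrow> 'm \<Rightarrow> 'm"
  Idm :: "'o \<Rightarrow> 'm"
  Add :: "'m \<Rightarrow> 'm \<Rightarrow> 'm"
  Neg :: "'m \<Rightarrow> 'm"
  Zer :: "'o \<Rightarrow> 'o \<Rightarrow> 'm"
  SigO :: "'o \<Rightarrow> 'o"
  SigM :: "'m \<Rightarrow> 'm"
  Dist :: "('m \<times> 'm \<times> 'm) set"

definition tHom :: "('o,'m) tcat \<Rightarrow> 'o \<Rightarrow> 'o \<Rightarrow> 'm set" where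
  "tHom C X Y = {f. Dom C f = X \<and> Cod C f = Y}"

definition is_category :: "('o,'m) tcat \<Rightarrow> bool" where
  "is_category C \<longleftrightarrow>
     (\<forall>X. Idm C X \<in> tHom C X X) \<and>
     (\<forall>f g. Cod C f = Dom C g \<longrightarrow> Comp C g f \<in> tHom C (Dom C f) (Cod C g)) \<and>
     (\<forall>f g h. Cod C f = Dom C g \<and> Cod C g = Dom C h \<longrightarrow>
         Comp C h (Comp C g f) = Comp C (Comp C h g) f) \<and>
     (\<forall>f. Comp C (Idm C (Cod C f)) f = f \<and> Comp C f (Idm C (Dom C f)) = f)"

definition is_preadditive :: "('o,'m) tcat \<Rightarrow> bool" where
  "is_preadditive C \<longleftrightarrow> is_category C \<and>
     (\<forall>X Y. Zer C X Y \<in> tHom C X Y \<and>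
        (\<forall>f\<in>tHom C X Y. \<forall>g\<in>tHom C X Y. Add C f g \<in> tHom C X Y) \<and>
        (\<forall>f\<in>tHom C X Y. Neg C f \<in> tHom C X Y) \<and>
        (\<forall>f\<in>tHom C X Y. \<forall>g\<in>tHom C X Y. \<forall>h\<in>tHom C X Y.
            Add C (Add C f g) h = Add C f (Add C g h)) \<and>
        (\<forall>f\<in>tHom C X Y. \<forall>g\<in>tHom C X Y. Add C f g = Add C g f) \<and>
        (\<forall>f\<in>tHom C X Y. Add C f (Zer C X Y) = f) \<and>
        (\<forall>f\<in>tHom C X Y. Add C f (Neg C f) = Zer C X Y)) \<and>
     (\<forall>X Y Z. \<forall>f\<in>tHom C X Y. \<forall>g\<in>tHom C X Y. \<forall>h\<in>tHom C Y Z.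
        Comp C h (Add C f g) = Add C (Comp C h f) (Comp C h g)) \<and>
     (\<forall>X Y Z. \<forall>f\<in>tHom C X Y. \<forall>g\<in>tHom C Y Z. \<forall>h\<in>tHom C Y Z.
        Comp C (Add C g h) f = Add C (Comp C g f) (Comp C h f))"

definition is_zero_obj :: "('o,'m) tcat \<Rightarrow> 'o \<Rightarrow> bool" where
  "is_zero_obj C Z0 \<longleftrightarrow> Idm C Z0 = Zer C Z0 Z0"

definition is_additive :: "('o,'m) tcat \<Rightarrow> bool" where
  "is_additive C \<longleftrightarrow> is_preadditive C \<and> (\<exists>Z0. is_zero_obj C Z0) \<and>
     (\<forall>X Y. \<exists>W i1 i2 p1 p2. i1 \<in> tHom C X W \<and> i2 \<in> tHom C Y W \<and>
        p1 \<in> tHom C W X \<and> p2 \<in> tHom C W Y \<and>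
        Comp C p1 i1 = Idm C X \<and> Comp C p2 i2 = Idm C Y \<and>
        Comp C p1 i2 = Zer C Y X \<and> Comp C p2 i1 = Zer C X Y \<and>
        Add C (Comp C i1 p1) (Comp C i2 p2) = Idm C W)"

definition is_susp :: "('o,'m) tcat \<Rightarrow> bool" where
  "is_susp C \<longleftrightarrow> bij (SigO C) \<and> bij (SigM C) \<and>
     (\<forall>f. Dom C (SigM C f) = SigO C (Dom C f) \<and> Cod C (SigM C f) = SigO C (Cod C f)) \<and>
     (\<forall>X. SigM C (Idm C X) = Idm C (SigO C X)) \<and>
     (\<forall>f g. Cod C f = Dom C g \<longrightarrow> SigM C (Comp C g f) = Comp C (SigM C g) (SigM C f)) \<and>
     (\<forall>X Y. \<forall>f\<in>tHom C X Y. \<forall>g\<in>tHom C X Y. SigM C (Add C f g) = Add C (SigM C f) (SigM C g))"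

definition is_triangle :: "('o,'m) tcat \<Rightarrow> 'm \<times> 'm \<times> 'm \<Rightarrow> bool" where
  "is_triangle C t = (case t of (f,g,h) \<Rightarrow>
     Cod C f = Dom C g \<and> Cod C g = Dom C h \<and> Cod C h = SigO C (Dom C f))"

definition is_iso :: "('o,'m) tcat \<Rightarrow> 'm \<Rightarrow> bool" where
  "is_iso C a \<longleftrightarrow> (\<exists>b\<in>tHom C (Cod C a) (Dom C a).
      Comp C b a = Idm C (Dom C a) \<and> Comp C a b = Idm C (Cod C a))"

definition tri_morph :: "('o,'m) tcat \<Rightarrow> 'm \<times> 'm \<times> 'm \<Rightarrow> 'm \<times> 'm \<times> 'm \<Rightarrow> 'm \<times> 'm \<times> 'm \<Rightarrow> bool" where
  "tri_morph C t t' m = (case (t, t', m) of ((f,g,h), (f',g',h'), (a,b,c)) \<Rightarrow>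
     a \<in> tHom C (Dom C f) (Dom C f') \<and> b \<in> tHom C (Dom C g) (Dom C g') \<and>
     c \<in> tHom C (Dom C h) (Dom C h') \<and>
     Comp C b f = Comp C f' a \<and> Comp C c g = Comp C g' b \<and>
     Comp C (SigM C a) h = Comp C h' c)"

definition is_triangulated :: "('o,'m) tcat \<Rightarrow> bool" where
  "is_triangulated C \<longleftrightarrow> is_additive C \<and> is_susp C \<and>
     (\<forall>t\<in>Dist C. is_triangle C t) \<and>
     \<comment> \<open>TR1\<close>
     (\<forall>X Z0. is_zero_obj C Z0 \<longrightarrow> (Idm C X, Zer C X Z0, Zer C Z0 (SigO C X)) \<in> Dist C) \<and>
     (\<forall>f. \<exists>g h. (f,g,h) \<in> Dist C) \<and>
     (\<forall>t t' a b c. t \<in> Dist C \<and> is_triangle C t' \<and> tri_morph C t t' (a,b,c) \<and>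
        is_iso C a \<and> is_iso C b \<and> is_iso C c \<longrightarrow> t' \<in> Dist C) \<and>
     \<comment> \<open>TR2\<close>
     (\<forall>f g h. is_triangle C (f,g,h) \<longrightarrow>
        ((f,g,h) \<in> Dist C \<longleftrightarrow> (g, h, Neg C (SigM C f)) \<in> Dist C)) \<and>
     \<comment> \<open>TR3\<close>
     (\<forall>f g h f' g' h' a b. (f,g,h) \<in> Dist C \<and> (f',g',h') \<in> Dist C \<and>
        a \<in> tHom C (Dom C f) (Dom C f') \<and> b \<in> tHom C (Cod C f) (Cod C f') \<and>
        Comp C b f = Comp C f' a \<longrightarrow> (\<exists>c. tri_morph C (f,g,h) (f',g',h') (a,b,c))) \<and>
     \<comment> \<open>TR4 (octahedral axiom)\<close>
     (\<forall>f g u u' v v' w w'. Cod C f = Dom C g \<and> (f,u,u') \<in> Dist C \<and> (g,v,v') \<in> Dist C \<and>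
        (Comp C g f, w, w') \<in> Dist C \<longrightarrow>
        (\<exists>a b. a \<in> tHom C (Cod C u) (Cod C w) \<and> b \<in> tHom C (Cod C w) (Cod C v) \<and>
           (a, b, Comp C (SigM C u) v') \<in> Dist C \<and>
           Comp C a u = Comp C w g \<and> Comp C w' a = u' \<and> Comp C b w = v \<and>
           Comp C (SigM C f) w' = Comp C v' b))"

definition SigPowO :: "('o,'m) tcat \<Rightarrow> int \<Rightarrow> 'o \<Rightarrow> 'o" where
  "SigPowO C n = (if n \<ge> 0 then SigO C ^^ nat n else inv (SigO C) ^^ nat (- n))"

definition SigPowM :: "('o,'m) tcat \<Rightarrow> int \<Rightarrow> 'm \<Rightarrow> 'm" where
  "SigPowM C n = (if n \<ge> 0 then SigM C ^^ nat n else inv (SigM C) ^^ nat (- n))"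

definition central_elt :: "('o,'m) tcat \<Rightarrow> int \<Rightarrow> ('o \<Rightarrow> 'm) \<Rightarrow> bool" where
  "central_elt C n eta \<longleftrightarrow>
     (\<forall>X. eta X \<in> tHom C X (SigPowO C n X)) \<and>
     (\<forall>f. Comp C (SigPowM C n f) (eta (Dom C f)) = Comp C (eta (Cod C f)) f) \<and>
     (\<forall>X. eta (SigO C X) = (if even n then SigM C (eta X) else Neg C (SigM C (eta X))))"

definition graded_ring :: "(nat \<Rightarrow> 'r::comm_ring_1 set) \<Rightarrow> bool" where
  "graded_ring Rg \<longleftrightarrow>
     (\<forall>n. 0 \<in> Rg n \<and> (\<forall>a\<in>Rg n. \<forall>b\<in>Rg n. a + b \<in> Rg n \<and> - a \<in> Rg n)) \<and>
     1 \<in> Rg 0 \<and>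
     (\<forall>m n. \<forall>a\<in>Rg m. \<forall>b\<in>Rg n. a * b \<in> Rg (m + n)) \<and>
     (\<forall>r. \<exists>!c. finite {k. c k \<noteq> 0} \<and> (\<forall>k. c k \<in> Rg k) \<and> r = (\<Sum>k\<in>{k. c k \<noteq> 0}. c k))"

definition generated_in_degree :: "(nat \<Rightarrow> 'r::comm_ring_1 set) \<Rightarrow> nat \<Rightarrow> bool" where
  "generated_in_degree Rg d \<longleftrightarrow>
     (\<forall>n. \<not> d dvd n \<longrightarrow> Rg n = {0}) \<and>
     (\<forall>k\<ge>1. \<forall>r\<in>Rg (d * (k + 1)). \<exists>(A::nat \<Rightarrow> 'r) (B::nat \<Rightarrow> 'r) N.
        (\<forall>j<N. A j \<in> Rg d \<and> B j \<in> Rg (d * k)) \<and> r = (\<Sum>j<N. A j * B j))"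

definition is_ideal :: "'r::comm_ring_1 set \<Rightarrow> bool" where
  "is_ideal I \<longleftrightarrow> 0 \<in> I \<and> (\<forall>a\<in>I. \<forall>b\<in>I. a + b \<in> I) \<and> (\<forall>r. \<forall>a\<in>I. r * a \<in> I)"

definition noetherian_ring :: "'r::comm_ring_1 itself \<Rightarrow> bool" where
  "noetherian_ring _ \<longleftrightarrow> (\<forall>I::'r set. is_ideal I \<longrightarrow>
     (\<exists>F. finite F \<and> F \<subseteq> I \<and> I = {(\<Sum>f\<in>F. c f * f) | c. True}))"

text \<open>Standing assumption: R Noetherian graded, generated over R^0 by R^d, d even, d \<ge> 2.
  (R is generated in even degrees, so graded-commutative means commutative.)\<close>
definition standing_ring :: "(nat \<Rightarrow> 'r::comm_ring_1 set) \<Rightarrow> nat \<Rightarrow> bool" where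
  "standing_ring Rg d \<longleftrightarrow> even d \<and> d \<ge> 2 \<and> graded_ring Rg \<and>
     generated_in_degree Rg d \<and> noetherian_ring TYPE('r)"

definition r_linear :: "('o,'m) tcat \<Rightarrow> (nat \<Rightarrow> 'r::comm_ring_1 set) \<Rightarrow> (nat \<Rightarrow> 'r \<Rightarrow> 'o \<Rightarrow> 'm) \<Rightarrow> bool" where
  "r_linear C Rg phi \<longleftrightarrow>
     (\<forall>n. \<forall>r\<in>Rg n. central_elt C (int n) (phi n r)) \<and>
     (\<forall>n. \<forall>r\<in>Rg n. \<forall>s\<in>Rg n. \<forall>X. phi n (r + s) X = Add C (phi n r X) (phi n s X)) \<and>
     (\<forall>m n. \<forall>r\<in>Rg m. \<forall>s\<in>Rg n. \<forall>X.
        phi (m + n) (r * s) X = Comp C (SigPowM C (int m) (phi n s X)) (phi m r X)) \<and>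
     (\<forall>X. phi 0 1 X = Idm C X)"

definition r0_submod where
  "r0_submod C Rg phi A B S \<longleftrightarrow> S \<subseteq> tHom C A B \<and> Zer C A B \<in> S \<and>
     (\<forall>f\<in>S. \<forall>g\<in>S. Add C f g \<in> S) \<and> (\<forall>a\<in>Rg 0. \<forall>f\<in>S. Comp C (phi 0 a B) f \<in> S)"

definition r0_chain where
  "r0_chain C Rg phi A B k \<longleftrightarrow> (\<exists>N::nat \<Rightarrow> 'm set.
     (\<forall>i\<le>k. r0_submod C Rg phi A B (N i)) \<and> (\<forall>i<k. N i \<subset> N (Suc i)))"

definition fin_length where
  "fin_length C Rg phi A B \<longleftrightarrow> bdd_above {k. r0_chain C Rg phi A B k}"

definition r0_length where
  "r0_length C Rg phi A B = (if fin_length C Rg phi A B then Max {k. r0_chain C Rg phi A B k} else 0)"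

definition lam :: "('o,'m) tcat \<Rightarrow> (nat \<Rightarrow> 'r::comm_ring_1 set) \<Rightarrow> (nat \<Rightarrow> 'r \<Rightarrow> 'o \<Rightarrow> 'm) \<Rightarrow> 'o \<Rightarrow> 'o \<Rightarrow> int \<Rightarrow> nat" where
  "lam C Rg phi X Y n = r0_length C Rg phi X (SigPowO C n Y)"

definition homvec where
  "homvec C X Y n0 v \<longleftrightarrow> (\<forall>n. v n \<in> tHom C X (SigPowO C n Y)) \<and>
     (\<forall>n<n0. v n = Zer C X (SigPowO C n Y)) \<and>
     finite {n. v n \<noteq> Zer C X (SigPowO C n Y)}"

definition hsmult where
  "hsmult C phi Y m r v = (\<lambda>n::int. Comp C (phi m r (SigPowO C (n - int m) Y)) (v (n - int m)))"

definition vadd where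
  "vadd C v w = (\<lambda>n::int. Add C (v n) (w n))"

definition hom_submod where
  "hom_submod C Rg phi X Y n0 S \<longleftrightarrow> S \<subseteq> Collect (homvec C X Y n0) \<and>
     (\<lambda>n. Zer C X (SigPowO C n Y)) \<in> S \<and>
     (\<forall>v\<in>S. \<forall>w\<in>S. vadd C v w \<in> S) \<and>
     (\<forall>m. \<forall>r\<in>Rg m. \<forall>v\<in>S. hsmult C phi Y m r v \<in> S)"

definition noeth_from where
  "noeth_from C Rg phi X Y n0 \<longleftrightarrow> (\<forall>S. hom_submod C Rg phi X Y n0 S \<longrightarrow>
     (\<exists>G. finite G \<and> G \<subseteq> S \<and> S = \<Inter>{T. hom_submod C Rg phi X Y n0 T \<and> G \<subseteq> T}))"

definition noeth_fl where
  "noeth_fl C Rg phi X Y \<longleftrightarrow> (\<exists>n0. noeth_from C Rg phi X Y n0) \<and>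
     (\<forall>n. fin_length C Rg phi X (SigPowO C n Y))"

definition hilb_poly :: "('o,'m) tcat \<Rightarrow> (nat \<Rightarrow> 'r::comm_ring_1 set) \<Rightarrow> (nat \<Rightarrow> 'r \<Rightarrow> 'o \<Rightarrow> 'm) \<Rightarrow> nat \<Rightarrow> 'o \<Rightarrow> 'o \<Rightarrow> nat \<Rightarrow> rat poly" where
  "hilb_poly C Rg phi d X Y i = (THE p. \<forall>\<^sub>F k in sequentially.
      poly p (of_nat k) = of_nat (lam C Rg phi X Y (int d * int k + int i)))"

text \<open>cx = 1 + max_i deg g_i, with deg 0 = -1.\<close>
definition cx where
  "cx C Rg phi d X Y = Max ((\<lambda>i. if hilb_poly C Rg phi d X Y i = 0 then 0
       else Suc (degree (hilb_poly C Rg phi d X Y i))) ` {..<d})"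

definition hfun where
  "hfun C Rg phi d X Y n = (\<Sum>i<d. (if even (n + int i) then 1 else -1) *
       int (lam C Rg phi X Y (n + int i)))"

definition Delta :: "nat \<Rightarrow> (int \<Rightarrow> int) \<Rightarrow> int \<Rightarrow> int" where
  "Delta d f = (\<lambda>n. f (n + int d) - f n)"

text \<open>e^s for s \<ge> 1 is the eventual value of Delta^(s-1) h; e^0 is the Euler
  characteristic (meaningful when lambda^n vanishes for n \<ll> 0 and n \<gg> 0).\<close>
definition emult :: "('o,'m) tcat \<Rightarrow> (nat \<Rightarrow> 'r::comm_ring_1 set) \<Rightarrow> (nat \<Rightarrow> 'r \<Rightarrow> 'o \<Rightarrow> 'm) \<Rightarrow> nat \<Rightarrow> 'o \<Rightarrow> 'o \<Rightarrow> nat \<Rightarrow> int" where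
  "emult C Rg phi d X Y s = (if s \<ge> 1
     then (THE c. \<forall>\<^sub>F n in at_top. (Delta d ^^ (s - 1)) (hfun C Rg phi d X Y) n = c)
     else (\<Sum>n\<in>{n. lam C Rg phi X Y n \<noteq> 0}. (if even n then 1 else -1) * int (lam C Rg phi X Y n)))"

end

theory Submission
  imports Defs
begin

text \<open>
  Fix a residue class modulo \<open>d\<close>. The modules \<open>Hom(X, \<Sigma>\<^sup>n Y)\<close> in that class form a sequence
  on which finitely many degree-\<open>d\<close> elements of \<open>R\<close> act, and Hilbert--Serre gives a polynomial
  \<open>g\<^sub>i\<close> for the lengths. For \<open>n\<close> large the module is generated from below by \<open>R\<^sup>d\<close>, so
  \<open>\<lambda>\<^sup>n = 0\<close> forces \<open>\<lambda>\<^bsup>n+d\<^esup> = 0\<close>. Vanishing for \<open>d/2\<close> consecutive values of one parity therefore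
  kills all \<open>g\<^sub>i\<close> with \<open>i\<close> of that parity. If \<open>s \<ge> 1\<close>, then \<open>e\<^sup>s = (s-1)! \<Sum> (-1)\<^sup>i [t\<^bsup>s-1\<^esup>] g\<^sub>i = 0\<close>
  becomes a vanishing sum of nonnegative numbers, one of which is positive: a contradiction, so the
  hypothesis on \<open>\<lambda>\<close> never holds. If \<open>s = 0\<close>, then \<open>\<lambda>\<^sup>n = 0\<close> for all large \<open>n\<close>.
\<close>

section \<open>Lengths of chains of sets\<close>

text \<open>Hom groups are sets of morphisms inside one type, and forming a quotient module would
  leave that type. The Hilbert--Serre induction is therefore run on pairs N <= P of graded
  submodules, where the length of P / N is read off as the longest chain of submodules between N and
  P. Kernel and cokernel of an operator are again such pairs. The Noetherian hypothesis enters in a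
  single form: in large degrees a graded submodule P is generated by the images of its previous term
  under the operators. Applied to the whole module, the same form yields the propagation of
  vanishing. The contradiction for s >= 1 rests on parity. As d is even, the sign (-1)^n is constant
  on each residue class. Once the classes of one parity have zero polynomial, the surviving terms of
  the alternating sum all carry the same sign, and their coefficients at t^(s-1) are nonnegative
  because lengths are.\<close>

definition chain_lengths :: "'a set set \<Rightarrow> nat set" where
  "chain_lengths L = {k. \<exists>c. (\<forall>i\<le>k. c i \<in> L) \<and> (\<forall>i<k. c i \<subset> c (Suc i))}"

definition height :: "'a set set \<Rightarrow> nat" where
  "height L = Max (chain_lengths L)"

text \<open>If \<open>L\<close> is the lattice of submodules, this interval is the lattice of
  submodules of P / N.\<close>

definition seg :: "'a set set \<Rightarrow> 'a set \<Rightarrow> 'a set \<Rightarrow> 'a set set" where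
  "seg L N P = {S \<in> L. N \<subseteq> S \<and> S \<subseteq> P}"

lemma chain_lengthsI:
  "(\<And>i. i \<le> k \<Longrightarrow> c i \<in> L) \<Longrightarrow> (\<And>i. i < k \<Longrightarrow> c i \<subset> c (Suc i)) \<Longrightarrow> k \<in> chain_lengths L"
  unfolding chain_lengths_def by blast

lemma zero_in_chain_lengths: "S \<in> L \<Longrightarrow> 0 \<in> chain_lengths L"
  by (rule chain_lengthsI[where c = "\<lambda>_. S"]) auto

lemma le_height: "finite (chain_lengths L) \<Longrightarrow> k \<in> chain_lengths L \<Longrightarrow> k \<le> height L"
  unfolding height_def by simp

lemma height_leI:
  assumes "S \<in> L" and "\<And>k. k \<in> chain_lengths L \<Longrightarrow> k \<le> b"
  shows "height L \<le> b"
proof -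
  have fin: "finite (chain_lengths L)"
    using assms(2) finite_nat_set_iff_bounded_le by blast
  show ?thesis
    unfolding height_def using fin assms zero_in_chain_lengths[OF assms(1)]
    by (subst Max_le_iff) auto
qed

lemma height_in: "S \<in> L \<Longrightarrow> finite (chain_lengths L) \<Longrightarrow> height L \<in> chain_lengths L"
  unfolding height_def using zero_in_chain_lengths by (intro Max_in) blast+

lemma chain_lengths_mono: "L \<subseteq> L' \<Longrightarrow> chain_lengths L \<subseteq> chain_lengths L'"
  unfolding chain_lengths_def by blast

lemma chain_lengths_image:
  assumes "k \<in> chain_lengths L"
    and "\<And>S. S \<in> L \<Longrightarrow> f S \<in> L'"
    and "\<And>S T. S \<in> L \<Longrightarrow> T \<in> L \<Longrightarrow> S \<subset> T \<Longrightarrow> f S \<subset> f T"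
  shows "k \<in> chain_lengths L'"
proof -
  obtain c where c: "\<And>i. i \<le> k \<Longrightarrow> c i \<in> L" "\<And>i. i < k \<Longrightarrow> c i \<subset> c (Suc i)"
    using assms(1) unfolding chain_lengths_def by blast
  show ?thesis
    by (rule chain_lengthsI[where c = "\<lambda>i. f (c i)"]) (use c assms(2,3) in auto)
qed

text \<open>Deleting repetitions from a weakly increasing sequence leaves a strict chain with one
  step for each strict inclusion.\<close>

lemma strict_steps:
  assumes "\<And>i. i \<le> k \<Longrightarrow> u i \<in> L" and "\<And>i. i < k \<Longrightarrow> u i \<subseteq> u (Suc i)"
  shows "card {i. i < k \<and> u i \<noteq> u (Suc i)} \<in> chain_lengths L"
proof -
  let ?n = "\<lambda>k. card {i. i < k \<and> u i \<noteq> u (Suc i)}"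
  \<comment> \<open>The induction has to remember that the thinned chain ends at \<open>u k\<close>,
    since that is where the next member is attached.\<close>
  have "\<exists>c. (\<forall>i\<le>?n k. c i \<in> L) \<and> (\<forall>i<?n k. c i \<subset> c (Suc i)) \<and> c (?n k) = u k"
    using assms
  proof (induction k)
    case 0
    show ?case by (rule exI[of _ "\<lambda>_. u 0"]) (use 0 in auto)
  next
    case (Suc k)
    then obtain c where c: "\<forall>i\<le>?n k. c i \<in> L" "\<forall>i<?n k. c i \<subset> c (Suc i)" "c (?n k) = u k"
      by (auto simp: less_Suc_eq)
    show ?case
    proof (cases "u k = u (Suc k)")
      case True
      then have "{i. i < Suc k \<and> u i \<noteq> u (Suc i)} = {i. i < k \<and> u i \<noteq> u (Suc i)}"
        by (auto simp: less_Suc_eq)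
      with c True show ?thesis by auto
    next
      case False
      then have "{i. i < Suc k \<and> u i \<noteq> u (Suc i)} = insert k {i. i < k \<and> u i \<noteq> u (Suc i)}"
        by (auto simp: less_Suc_eq)
      then have n: "?n (Suc k) = Suc (?n k)" by simp
      have "u k \<subset> u (Suc k)" using False Suc.prems(2)[of k] by auto
      then show ?thesis unfolding n
        by (intro exI[of _ "c(Suc (?n k) := u (Suc k))"])
          (use c Suc.prems(1)[of "Suc k"] in \<open>auto simp: less_Suc_eq le_Suc_eq\<close>)
    qed
  qed
  then show ?thesis unfolding chain_lengths_def by blast
qed

text \<open>Abstract subadditivity of length. By \<open>inj\<close>, each strict step of a chain
  stays strict under \<open>f\<close> or under \<open>g\<close>, so the steps are covered by two
  sets whose sizes the two heights bound. Later \<open>f\<close> intersects with a submodule and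
  \<open>g\<close> adds it.\<close>

lemma chain_length_le_add:
  assumes fin: "finite (chain_lengths L1)" "finite (chain_lengths L2)"
    and f: "\<And>S. S \<in> L \<Longrightarrow> f S \<in> L1" "\<And>S T. S \<subseteq> T \<Longrightarrow> f S \<subseteq> f T"
    and g: "\<And>S. S \<in> L \<Longrightarrow> g S \<in> L2" "\<And>S T. S \<subseteq> T \<Longrightarrow> g S \<subseteq> g T"
    and inj: "\<And>S T. S \<in> L \<Longrightarrow> T \<in> L \<Longrightarrow> S \<subseteq> T \<Longrightarrow> f S = f T \<Longrightarrow> g S = g T \<Longrightarrow> S = T"
    and k: "k \<in> chain_lengths L"
  shows "k \<le> height L1 + height L2"
proof -
  obtain c where c: "\<And>i. i \<le> k \<Longrightarrow> c i \<in> L" "\<And>i. i < k \<Longrightarrow> c i \<subset> c (Suc i)"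
    using k unfolding chain_lengths_def by blast
  let ?F = "{i. i < k \<and> f (c i) \<noteq> f (c (Suc i))}" and ?G = "{i. i < k \<and> g (c i) \<noteq> g (c (Suc i))}"
  have "f (c i) \<noteq> f (c (Suc i)) \<or> g (c i) \<noteq> g (c (Suc i))" if "i < k" for i
    using inj[of "c i" "c (Suc i)"] c(1)[of i] c(1)[of "Suc i"] c(2)[of i] that by auto
  then have "{..<k} \<subseteq> ?F \<union> ?G" by auto
  then have "k \<le> card (?F \<union> ?G)" using card_mono[of "?F \<union> ?G" "{..<k}"] by simp
  also have "\<dots> \<le> card ?F + card ?G" by (rule card_Un_le)
  also have "\<dots> \<le> height L1 + height L2"
    using c(1) f(1) g(1) psubset_imp_subset[OF c(2)]
    by (intro add_mono le_height fin strict_steps f(2) g(2)) auto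
  finally show ?thesis .
qed

lemma height_seg_add_le:
  assumes "N \<in> L" "B \<in> L" "N \<subseteq> B" "B \<subseteq> P" and fin: "finite (chain_lengths (seg L N P))"
  shows "height (seg L N B) + height (seg L B P) \<le> height (seg L N P)"
proof -
  have sub: "seg L N B \<subseteq> seg L N P" "seg L B P \<subseteq> seg L N P"
    using assms unfolding seg_def by auto
  define a b where "a = height (seg L N B)" and "b = height (seg L B P)"
  have "a \<in> chain_lengths (seg L N B)" unfolding a_def
    by (rule height_in[of N]) (use assms finite_subset[OF chain_lengths_mono[OF sub(1)]] in \<open>auto simp: seg_def\<close>)
  then obtain c where c: "\<And>i. i \<le> a \<Longrightarrow> c i \<in> seg L N B" "\<And>i. i < a \<Longrightarrow> c i \<subset> c (Suc i)"
    unfolding chain_lengths_def by blast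
  have "b \<in> chain_lengths (seg L B P)" unfolding b_def
    by (rule height_in[of B]) (use assms finite_subset[OF chain_lengths_mono[OF sub(2)]] in \<open>auto simp: seg_def\<close>)
  then obtain c' where c': "\<And>i. i \<le> b \<Longrightarrow> c' i \<in> seg L B P" "\<And>i. i < b \<Longrightarrow> c' i \<subset> c' (Suc i)"
    unfolding chain_lengths_def by blast
  have "a + b \<in> chain_lengths (seg L N P)"
  \<comment> \<open>The end \<open>c a\<close> of the lower chain and the start \<open>c' 0\<close>
    of the upper one may differ. The member \<open>c' 0\<close> is skipped, and
    \<open>c a \<subseteq> B \<subseteq> c' 0 \<subset> c' 1\<close> keeps the step at
    \<open>a\<close> strict.\<close>
  proof (rule chain_lengthsI[where c = "\<lambda>i. if i \<le> a then c i else c' (i - a)"])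
    fix i assume "i \<le> a + b"
    then show "(if i \<le> a then c i else c' (i - a)) \<in> seg L N P"
      using c(1)[of i] c'(1)[of "i - a"] sub by auto
  next
    fix i assume i: "i < a + b"
    show "(if i \<le> a then c i else c' (i - a)) \<subset> (if Suc i \<le> a then c (Suc i) else c' (Suc i - a))"
    proof (cases "i < a")
      case False
      have "(if i \<le> a then c i else c' (i - a)) \<subseteq> c' (i - a)"
        using c(1)[of a] c'(1)[of 0] False by (auto simp: seg_def)
      also have "\<dots> \<subset> c' (Suc (i - a))" using c'(2)[of "i - a"] i False by auto
      finally show ?thesis using False by (simp add: Suc_diff_le)
    qed (use c in auto)
  qed
  then show ?thesis using le_height[OF fin] unfolding a_def b_def by simp
qed

section \<open>Functions that are eventually polynomial\<close>

definition shift_diff :: "'a::comm_ring_1 poly \<Rightarrow> 'a poly" where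
  "shift_diff p = pcompose p [:1, 1:] - p"

lemma poly_shift_diff: "poly (shift_diff p) x = poly p (x + 1) - poly p x"
  by (simp add: shift_diff_def poly_pcompose add.commute)

lemma shift_diff_pCons: "shift_diff (pCons a q) = pCons 0 (shift_diff q) + shift_diff q + q"
  by (simp add: shift_diff_def pcompose_pCons algebra_simps) 

text \<open>Writing p = a + x q turns the difference of p into x Dq + Dq + q, with D the difference
  operator, and the coefficients follow by induction. A bound on the degree, rather than its exact
  value, lets one formula also cover polynomials of lower degree, where both coefficients are
  0.\<close>

lemma shift_diff_degree:
  "degree p \<le> Suc m \<Longrightarrow>
    degree (shift_diff p) \<le> m \<and> coeff (shift_diff p) m = of_nat (Suc m) * coeff p (Suc m)"
proof (induction m arbitrary: p)
  case 0
  obtain a q where p: "p = pCons a q" by (cases p)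
  then have "degree q = 0" using 0 by (cases "q = 0") auto
  then obtain b where "q = [:b:]" by (rule degree_eq_zeroE)
  with p show ?case by (simp add: shift_diff_pCons) (simp add: shift_diff_def)
next
  case (Suc m)
  obtain a q where p: "p = pCons a q" by (cases p)
  then have q: "degree q \<le> Suc m" using Suc.prems by (cases "q = 0") auto
  from Suc.IH[OF q] have IH: "degree (shift_diff q) \<le> m"
    "coeff (shift_diff q) m = of_nat (Suc m) * coeff q (Suc m)" by auto
  then have "degree (pCons 0 (shift_diff q)) \<le> Suc m" "coeff (shift_diff q) (Suc m) = 0"
    by (auto intro: order.trans[OF degree_pCons_le] coeff_eq_0)
  with IH q show ?case unfolding p shift_diff_pCons
    by (auto intro!: degree_add_le simp: algebra_simps)
qed

text \<open>A monomial of degree n + 1 has a difference of degree n. In characteristic 0 its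
  coefficient can be chosen to match the leading term of \<open>p\<close>, and the remainder is
  handled by induction on the degree.\<close>

lemma shift_diff_surj: "\<exists>q. shift_diff q = (p :: 'a::field_char_0 poly)"
proof (induction "degree p" arbitrary: p rule: less_induct)
  case less
  define n where "n = degree p"
  define q0 where "q0 = monom (lead_coeff p / of_nat (Suc n)) (Suc n)"
  have d: "degree (shift_diff q0) \<le> n" "coeff (shift_diff q0) n = lead_coeff p"
    using shift_diff_degree[of q0 n] degree_monom_le[of "lead_coeff p / of_nat (Suc n)" "Suc n"]
    by (auto simp: q0_def simp del: of_nat_Suc)
  have lin: "shift_diff (a + b) = shift_diff a + shift_diff b" for a b :: "'a poly"
    by (simp add: shift_diff_def pcompose_add)
  show ?case
  proof (cases "p - shift_diff q0 = 0")
    case False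
    then have "degree (p - shift_diff q0) < degree p \<or> n = 0"
      using d degree_diff_le[of p n "shift_diff q0"] unfolding n_def
      by (metis coeff_diff diff_self leading_coeff_0_iff order.order_iff_strict order_refl)
    \<comment> \<open>In degree 0 the remainder is a constant whose only coefficient has just been
      cancelled, so it would be zero.\<close>
    moreover have "n \<noteq> 0"
    proof
      assume n: "n = 0"
      then have "degree (p - shift_diff q0) = 0"
        using d degree_diff_le[of p n "shift_diff q0"] unfolding n_def by simp
      moreover have "coeff (p - shift_diff q0) 0 = 0" using d n unfolding n_def by simp
      ultimately show False using False leading_coeff_0_iff by metis
    qed
    ultimately obtain q where "shift_diff q = p - shift_diff q0" using less by metis
    then show ?thesis by (intro exI[of _ "q + q0"]) (simp add: lin)
  qed auto
qed

definition eventually_poly :: "(nat \<Rightarrow> 'a::field_char_0) \<Rightarrow> bool" where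
  "eventually_poly f \<longleftrightarrow> (\<exists>p. \<forall>\<^sub>F k in sequentially. poly p (of_nat k) = f k)"

lemma eventually_poly_diff:
  assumes "eventually_poly f" "eventually_poly g"
  shows "eventually_poly (\<lambda>k. f k - g k)"
proof -
  obtain p q where "\<forall>\<^sub>F k in sequentially. poly p (of_nat k) = f k"
    "\<forall>\<^sub>F k in sequentially. poly q (of_nat k) = g k"
    using assms unfolding eventually_poly_def by auto
  then have "\<forall>\<^sub>F k in sequentially. poly (p - q) (of_nat k) = f k - g k"
    by eventually_elim simp
  then show ?thesis unfolding eventually_poly_def by blast
qed

lemma eventually_poly_offset:
  "eventually_poly (\<lambda>k. f (k + m)) \<longleftrightarrow> eventually_poly f"
proof
  assume "eventually_poly (\<lambda>k. f (k + m))"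
  then obtain p where "\<forall>\<^sub>F k in sequentially. poly p (of_nat k) = f (k + m)"
    unfolding eventually_poly_def by auto
  then obtain K where K: "\<And>k. k \<ge> K \<Longrightarrow> poly p (of_nat k) = f (k + m)"
    unfolding eventually_sequentially by auto
  have "poly (pcompose p [:- of_nat m, 1:]) (of_nat k) = f k" if "k \<ge> K + m" for k
    using K[of "k - m"] that by (simp add: poly_pcompose of_nat_diff)
  then show "eventually_poly f" unfolding eventually_poly_def eventually_sequentially by blast
next
  assume "eventually_poly f"
  then obtain p K where K: "\<And>k. k \<ge> K \<Longrightarrow> poly p (of_nat k) = f k"
    unfolding eventually_poly_def eventually_sequentially by auto
  have "poly (pcompose p [:of_nat m, 1:]) (of_nat k) = f (k + m)" if "k \<ge> K" for k
    using K[of "k + m"] that by (simp add: poly_pcompose add.commute)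
  then show "eventually_poly (\<lambda>k. f (k + m))"
    unfolding eventually_poly_def eventually_sequentially by blast
qed

text \<open>An antidifference of the polynomial for the increments has the same increments as
  \<open>f\<close> from \<open>K\<close> on, so the two differ there by a constant.\<close>

lemma eventually_poly_step:
  assumes "eventually_poly (\<lambda>k. f (Suc k) - f k)"
  shows "eventually_poly f"
proof -
  obtain p K where K: "\<And>k. k \<ge> K \<Longrightarrow> poly p (of_nat k) = f (Suc k) - f k"
    using assms unfolding eventually_poly_def eventually_sequentially by auto
  obtain q where q: "shift_diff q = p" using shift_diff_surj by blast
  define c where "c = f K - poly q (of_nat K)"
  have "poly (q + [:c:]) (of_nat k) = f k" if "k \<ge> K" for k
    using that
  proof (induction k rule: dec_induct)
    case (step k)
    have "poly q (of_nat (Suc k)) = poly q (of_nat k) + (f (Suc k) - f k)"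
      unfolding K[OF step(1), symmetric] using poly_shift_diff[of q "of_nat k"] q
      by (simp add: add.commute)
    then have "poly (q + [:c:]) (of_nat (Suc k)) = poly (q + [:c:]) (of_nat k) + (f (Suc k) - f k)"
      by simp
    with step.IH show ?case by simp
  qed (simp add: c_def)
  then show ?thesis unfolding eventually_poly_def eventually_sequentially by blast
qed

text \<open>The difference has infinitely many roots. This is what makes the definite description in
  \<open>hilb_poly\<close> denote.\<close>

lemma eventually_poly_unique:
  fixes p q :: "'a::field_char_0 poly"
  assumes "\<forall>\<^sub>F k in sequentially. poly p (of_nat k) = poly q (of_nat k)"
  shows "p = q"
proof (rule ccontr)
  assume "p \<noteq> q"
  then have "finite {x. poly (p - q) x = 0}" by (intro poly_roots_finite) simp
  moreover obtain K where "\<And>k. k \<ge> K \<Longrightarrow> poly p (of_nat k) = poly q (of_nat k)"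
    using assms unfolding eventually_sequentially by auto
  then have "of_nat ` {K..} \<subseteq> {x::'a. poly (p - q) x = 0}" by auto
  ultimately have "finite ((of_nat :: nat \<Rightarrow> 'a) ` {K..})" using finite_subset by blast
  then have "finite {K..}" by (rule finite_imageD) (simp add: inj_on_def)
  then show False using infinite_Ici by blast
qed

section \<open>Hilbert--Serre for sequences of modules\<close>

text \<open>
  Additive inverses come from the scalar \<open>e\<close>, which plays the role of \<open>-1\<close>; hence a submodule need
  only be closed under sums and scalars.
\<close>
locale module_sequence =
  fixes M :: "nat \<Rightarrow> 'a set" and add :: "'a \<Rightarrow> 'a \<Rightarrow> 'a" and zero :: "nat \<Rightarrow> 'a"
    and A :: "'s set" and act :: "'s \<Rightarrow> nat \<Rightarrow> 'a \<Rightarrow> 'a" and e :: 's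
    and J :: "'j set" and x :: "'j \<Rightarrow> nat \<Rightarrow> 'a \<Rightarrow> 'a"
  assumes zero_closed: "zero k \<in> M k"
    and add_closed: "f \<in> M k \<Longrightarrow> g \<in> M k \<Longrightarrow> add f g \<in> M k"
    and add_assoc: "f \<in> M k \<Longrightarrow> g \<in> M k \<Longrightarrow> h \<in> M k \<Longrightarrow> add (add f g) h = add f (add g h)"
    and add_commute: "f \<in> M k \<Longrightarrow> g \<in> M k \<Longrightarrow> add f g = add g f"
    and add_zero: "f \<in> M k \<Longrightarrow> add f (zero k) = f"
    and act_closed: "a \<in> A \<Longrightarrow> f \<in> M k \<Longrightarrow> act a k f \<in> M k"
    and act_add: "a \<in> A \<Longrightarrow> f \<in> M k \<Longrightarrow> g \<in> M k \<Longrightarrow> act a k (add f g) = add (act a k f) (act a k g)"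
    and e_in: "e \<in> A"
    and add_neg: "f \<in> M k \<Longrightarrow> add f (act e k f) = zero k"
    and x_closed: "j \<in> J \<Longrightarrow> f \<in> M k \<Longrightarrow> x j k f \<in> M (Suc k)"
    and x_add: "j \<in> J \<Longrightarrow> f \<in> M k \<Longrightarrow> g \<in> M k \<Longrightarrow> x j k (add f g) = add (x j k f) (x j k g)"
    and x_act: "j \<in> J \<Longrightarrow> a \<in> A \<Longrightarrow> f \<in> M k \<Longrightarrow> x j k (act a k f) = act a (Suc k) (x j k f)"
    and x_commute: "i \<in> J \<Longrightarrow> j \<in> J \<Longrightarrow> f \<in> M k \<Longrightarrow> x i (Suc k) (x j k f) = x j (Suc k) (x i k f)"
begin

section \<open>Submodules and the correspondence between submodules along an operator\<close>

definition Sub :: "nat \<Rightarrow> 'a set set" where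
  "Sub k = {S. S \<subseteq> M k \<and> zero k \<in> S \<and> (\<forall>f\<in>S. \<forall>g\<in>S. add f g \<in> S) \<and> (\<forall>a\<in>A. \<forall>f\<in>S. act a k f \<in> S)}"

definition Graded_Sub :: "(nat \<Rightarrow> 'a set) \<Rightarrow> bool" where
  "Graded_Sub P \<longleftrightarrow> (\<forall>k. P k \<in> Sub k \<and> (\<forall>j\<in>J. x j k ` P k \<subseteq> P (Suc k)))"

abbreviation neg :: "nat \<Rightarrow> 'a \<Rightarrow> 'a" where "neg k \<equiv> act e k"

abbreviation len :: "nat \<Rightarrow> 'a set \<Rightarrow> 'a set \<Rightarrow> nat" where
  "len k N P \<equiv> height (seg (Sub k) N P)"

lemma SubD:
  assumes "S \<in> Sub k"
  shows "S \<subseteq> M k" "f \<in> S \<Longrightarrow> f \<in> M k" "zero k \<in> S" "f \<in> S \<Longrightarrow> g \<in> S \<Longrightarrow> add f g \<in> S"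
    "a \<in> A \<Longrightarrow> f \<in> S \<Longrightarrow> act a k f \<in> S"
  using assms unfolding Sub_def by auto

lemma neg_closed: "f \<in> M k \<Longrightarrow> neg k f \<in> M k"
  by (rule act_closed[OF e_in])

lemma add_neg_cancel: "f \<in> M k \<Longrightarrow> g \<in> M k \<Longrightarrow> add (add f g) (neg k g) = f"
  by (simp add: add_assoc[of f k] neg_closed add_neg add_zero)

lemma add_neg_cancel_left: "f \<in> M k \<Longrightarrow> g \<in> M k \<Longrightarrow> add (add f g) (neg k f) = g"
  using add_neg_cancel add_commute by metis

lemma idem_zero: "f \<in> M k \<Longrightarrow> add f f = f \<Longrightarrow> f = zero k"
  using add_neg_cancel[of f k f] add_neg by simp

lemma act_zero: "a \<in> A \<Longrightarrow> act a k (zero k) = zero k"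
  by (rule idem_zero) (use act_closed act_add[of a "zero k" k "zero k"] zero_closed add_zero in auto)

lemma x_zero: "j \<in> J \<Longrightarrow> x j k (zero k) = zero (Suc k)"
  by (rule idem_zero) (use x_closed x_add[of j "zero k" k "zero k"] zero_closed add_zero in auto)

lemma zero_add: "f \<in> M k \<Longrightarrow> add (zero k) f = f"
  using add_commute[of f k "zero k"] add_zero zero_closed by simp

lemma M_in_Sub: "M k \<in> Sub k"
  unfolding Sub_def using zero_closed add_closed act_closed by auto

lemma zero_in_Sub: "{zero k} \<in> Sub k"
  unfolding Sub_def using zero_closed add_zero act_zero by auto

lemma Int_in_Sub: "S \<in> Sub k \<Longrightarrow> T \<in> Sub k \<Longrightarrow> S \<inter> T \<in> Sub k"
  unfolding Sub_def by auto

definition plus :: "'a set \<Rightarrow> 'a set \<Rightarrow> 'a set" where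
  "plus S T = {add f g | f g. f \<in> S \<and> g \<in> T}"

lemma add_add_swap:
  assumes "a \<in> M k" "b \<in> M k" "c \<in> M k" "d \<in> M k"
  shows "add (add a b) (add c d) = add (add a c) (add b d)"
proof -
  have "add (add a b) (add c d) = add a (add (add b c) d)"
    using assms by (simp add: add_assoc[where k = k] add_closed)
  also have "\<dots> = add a (add (add c b) d)" using add_commute assms by metis
  also have "\<dots> = add (add a c) (add b d)"
    using assms by (simp add: add_assoc[where k = k] add_closed)
  finally show ?thesis .
qed

lemma plus_in_Sub:
  assumes S: "S \<in> Sub k" and T: "T \<in> Sub k"
  shows "plus S T \<in> Sub k"
  unfolding Sub_def plus_def
proof (safe, goal_cases)
  case (1 _ f g)
  then show ?case using SubD(2)[OF S] SubD(2)[OF T] add_closed by auto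
next
  case 2
  show ?case using SubD(3)[OF S] SubD(3)[OF T] add_zero[OF zero_closed, of k] by (metis)
next
  case (3 _ _ f f' g g')
  then have "add (add f g) (add f' g') = add (add f f') (add g g')"
    using add_add_swap[of f k g f' g'] SubD(2)[OF S] SubD(2)[OF T] by auto
  then show ?case using 3 SubD(4)[OF S] SubD(4)[OF T] by metis
next
  case (4 a _ f g)
  then have "act a k (add f g) = add (act a k f) (act a k g)"
    using act_add[of a f k g] SubD(2)[OF S] SubD(2)[OF T] by auto
  then show ?case using 4 SubD(5)[OF S] SubD(5)[OF T] by metis
qed

lemma plus_upper:
  assumes "S \<in> Sub k" "T \<in> Sub k"
  shows "S \<subseteq> plus S T" "T \<subseteq> plus S T"
proof -
  show "S \<subseteq> plus S T"
    unfolding plus_def using SubD(2)[OF assms(1)] SubD(3)[OF assms(2)] add_zero by force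
  show "T \<subseteq> plus S T"
    unfolding plus_def using SubD(3)[OF assms(1)] SubD(2)[OF assms(2)] zero_add by force
qed

lemma plus_least: "S \<subseteq> B \<Longrightarrow> T \<subseteq> B \<Longrightarrow> B \<in> Sub k \<Longrightarrow> plus S T \<subseteq> B"
  unfolding plus_def using SubD(4) by blast

text \<open>The modular law, in the shape of the joint injectivity that
  \<open>chain_length_le_add\<close> asks for: if t = s + d, then d = t - s lies in T and D, hence
  in S, and so does t.\<close>

lemma modular_cancel:
  assumes S: "S \<in> Sub k" and T: "T \<in> Sub k" and D: "D \<in> Sub k"
    and "S \<subseteq> T" "S \<inter> D = T \<inter> D" "plus S D = plus T D"
  shows "S = T"
proof
  show "T \<subseteq> S"
  proof
    fix t assume t: "t \<in> T"
    then have "t \<in> plus S D" using plus_upper(1)[OF T D] assms(6) by auto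
    then obtain s d where sd: "s \<in> S" "d \<in> D" "t = add s d" unfolding plus_def by auto
    then have "add t (neg k s) = d" using add_neg_cancel_left SubD(2)[OF S] SubD(2)[OF D] by simp
    moreover have "add t (neg k s) \<in> T" using t sd assms(4) SubD(4,5)[OF T] e_in by blast
    ultimately have "d \<in> S" using sd assms(5) by auto
    then show "t \<in> S" using sd SubD(4)[OF S] by auto
  qed
qed fact

lemma image_in_Sub:
  assumes j: "j \<in> J" and S: "S \<in> Sub k"
  shows "x j k ` S \<in> Sub (Suc k)"
proof -
  have "add (x j k f) (x j k g) \<in> x j k ` S" if "f \<in> S" "g \<in> S" for f g
    using x_add[OF j, of f k g] SubD(2,4)[OF S] that by (metis image_eqI)
  moreover have "act a (Suc k) (x j k f) \<in> x j k ` S" if "a \<in> A" "f \<in> S" for a f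
    using x_act[OF j, of a f k] SubD(2,5)[OF S] that by (metis image_eqI)
  moreover have "zero (Suc k) \<in> x j k ` S"
    using x_zero[OF j, of k] SubD(3)[OF S] by (metis image_eqI)
  ultimately show ?thesis
    unfolding Sub_def using x_closed[OF j] SubD(2)[OF S] by auto
qed

lemma preimage_in_Sub:
  assumes j: "j \<in> J" and P: "P \<in> Sub k" and N: "N \<in> Sub (Suc k)"
  shows "{p \<in> P. x j k p \<in> N} \<in> Sub k"
  unfolding Sub_def
  using SubD[OF P] SubD[OF N] x_zero[OF j] x_add[OF j] x_act[OF j] by auto

text \<open>Half of the correspondence of submodules along the map P / K -> (x P + N) / N induced by
  \<open>x j\<close>. Image followed by preimage adds only elements of the kernel K, which
  \<open>S\<close> already contains.\<close>

lemma mult_recover: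
  assumes j: "j \<in> J" and P: "P \<in> Sub k" and N: "N \<in> Sub (Suc k)"
    and S: "S \<in> seg (Sub k) {p \<in> P. x j k p \<in> N} P"
  shows "{p \<in> P. x j k p \<in> plus (x j k ` S) N} = S"
proof -
  have S': "S \<in> Sub k" "{p \<in> P. x j k p \<in> N} \<subseteq> S" "S \<subseteq> P" using S unfolding seg_def by auto
  have "p \<in> S" if p: "p \<in> P" "x j k p \<in> plus (x j k ` S) N" for p
  proof -
    obtain s n where sn: "s \<in> S" "n \<in> N" "x j k p = add (x j k s) n"
      using p unfolding plus_def by auto
    note mem = SubD(2)[OF S'(1) sn(1)] SubD(2)[OF P p(1)] SubD(2)[OF N sn(2)]
    have q: "add p (neg k s) \<in> P" using p sn S' SubD(4,5)[OF P] e_in by blast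
    have "x j k (add p (neg k s)) = add (x j k p) (neg (Suc k) (x j k s))"
      using x_add[OF j] x_act[OF j e_in] mem neg_closed by simp
    also have "\<dots> = n" using sn(3) add_neg_cancel_left x_closed[OF j] mem by simp
    finally have "add p (neg k s) \<in> S" using q sn S' by auto
    then have "add (add p (neg k s)) s \<in> S" using sn SubD(4)[OF S'(1)] by auto
    also have "add (add p (neg k s)) s = p"
      using mem by (metis add_assoc add_commute add_neg add_zero neg_closed)
    finally show ?thesis .
  qed
  moreover have "x j k s \<in> plus (x j k ` S) N" if "s \<in> S" for s
    using plus_upper(1)[OF image_in_Sub[OF j S'(1)] N] that by auto
  ultimately show ?thesis using S' by auto
qed

text \<open>The other half: an element x p + n of \<open>B\<close> has n in
  \<open>N \<subseteq> B\<close>, so x p itself lies in \<open>B\<close> and p lies in the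
  preimage.\<close>

lemma mult_recover_target:
  assumes j: "j \<in> J" and P: "P \<in> Sub k" and N: "N \<in> Sub (Suc k)"
    and B: "B \<in> seg (Sub (Suc k)) N (plus (x j k ` P) N)"
  shows "plus (x j k ` {p \<in> P. x j k p \<in> B}) N = B"
proof
  have B': "B \<in> Sub (Suc k)" "N \<subseteq> B" "B \<subseteq> plus (x j k ` P) N" using B unfolding seg_def by auto
  show "plus (x j k ` {p \<in> P. x j k p \<in> B}) N \<subseteq> B"
    by (rule plus_least) (use B' in auto)
  show "B \<subseteq> plus (x j k ` {p \<in> P. x j k p \<in> B}) N"
  proof
    fix b assume b: "b \<in> B"
    then obtain p n where pn: "p \<in> P" "n \<in> N" "b = add (x j k p) n"
      using B' unfolding plus_def by auto
    have "add b (neg (Suc k) n) = x j k p"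
      using pn add_neg_cancel x_closed[OF j] SubD(2)[OF P] SubD(2)[OF N] by simp
    moreover have "add b (neg (Suc k) n) \<in> B"
      using b pn B' SubD(4,5)[OF B'(1)] e_in by blast
    ultimately show "b \<in> plus (x j k ` {p \<in> P. x j k p \<in> B}) N"
      using pn unfolding plus_def by auto
  qed
qed

lemma plus_mono: "S \<subseteq> T \<Longrightarrow> plus S D \<subseteq> plus T D"
  unfolding plus_def by blast

end

section \<open>Additivity of length and invariance under isomorphism\<close>

locale finite_length_sequence = module_sequence +
  assumes finite_length: "finite (chain_lengths (Sub k))"
begin

lemma finite_seg: "finite (chain_lengths (seg (Sub k) N P))"
  by (rule finite_subset[OF chain_lengths_mono finite_length[of k]]) (auto simp: seg_def)

text \<open>One inequality concatenates chains. For the other, a chain from N to P is traced on B by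
  intersection and pushed above B by sum.\<close>

lemma len_add:
  assumes N: "N \<in> Sub k" and B: "B \<in> Sub k" and P: "P \<in> Sub k" and "N \<subseteq> B" "B \<subseteq> P"
  shows "len k N P = len k N B + len k B P"
proof (rule antisym)
  show "len k N B + len k B P \<le> len k N P"
    by (rule height_seg_add_le) (use assms finite_seg in auto)
  show "len k N P \<le> len k N B + len k B P"
  proof (rule height_leI[of N])
    show "N \<in> seg (Sub k) N P" using assms unfolding seg_def by auto
    fix m assume "m \<in> chain_lengths (seg (Sub k) N P)"
    then show "m \<le> len k N B + len k B P"
    proof (rule chain_length_le_add[OF finite_seg finite_seg, rotated -1,
          where f = "\<lambda>S. S \<inter> B" and g = "\<lambda>S. plus S B"])
      show "S = T" if "S \<in> seg (Sub k) N P" "T \<in> seg (Sub k) N P" "S \<subseteq> T"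
        "S \<inter> B = T \<inter> B" "plus S B = plus T B" for S T
        by (rule modular_cancel[OF _ _ B]) (use that in \<open>auto simp: seg_def\<close>)
      show "S \<inter> B \<in> seg (Sub k) N B" if "S \<in> seg (Sub k) N P" for S
        using that Int_in_Sub[OF _ B] assms(4) by (auto simp: seg_def)
      show "plus S B \<in> seg (Sub k) B P" if "S \<in> seg (Sub k) N P" for S
        using that plus_in_Sub[OF _ B] plus_upper(2)[OF _ B] plus_least[OF _ assms(5) P]
        by (simp add: seg_def)
      show "plus S B \<subseteq> plus T B" if "S \<subseteq> T" for S T using that by (rule plus_mono)
      show "S \<inter> B \<subseteq> T \<inter> B" if "S \<subseteq> T" for S T using that by blast
    qed
  qed
qed

text \<open>First isomorphism theorem P / K = (x P + N) / N at the level of lengths. Image and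
  preimage are monotone and mutually inverse on the two intervals, hence strictly monotone, and
  carry chains in both directions.\<close>

lemma len_mult:
  assumes j: "j \<in> J" and P: "P \<in> Sub k" and N: "N \<in> Sub (Suc k)"
  shows "len k {p \<in> P. x j k p \<in> N} P = len (Suc k) N (plus (x j k ` P) N)"
proof (rule antisym)
  let ?K = "{p \<in> P. x j k p \<in> N}" and ?I = "plus (x j k ` P) N"
  let ?L = "seg (Sub k) ?K P" and ?L' = "seg (Sub (Suc k)) N ?I"
  let ?f = "\<lambda>S. plus (x j k ` S) N" and ?g = "\<lambda>B. {p \<in> P. x j k p \<in> B}"
  have K: "?K \<in> ?L" using preimage_in_Sub[OF assms] by (auto simp: seg_def)
  have N': "N \<in> ?L'" using N plus_upper(2)[OF image_in_Sub[OF j P] N] by (auto simp: seg_def)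
  have f: "?f S \<in> ?L'" if "S \<in> ?L" for S
    using that plus_in_Sub[OF image_in_Sub[OF j] N] plus_upper(2)[OF image_in_Sub[OF j] N]
      plus_mono[of "x j k ` S" "x j k ` P" N] by (auto simp: seg_def image_mono)
  have g: "?g B \<in> ?L" if "B \<in> ?L'" for B
    using that preimage_in_Sub[OF j P] by (auto simp: seg_def)
  have f_strict: "?f S \<subset> ?f T" if "S \<in> ?L" "T \<in> ?L" "S \<subset> T" for S T
  proof -
    have "?f S \<noteq> ?f T"
    proof
      assume "?f S = ?f T"
      then have "?g (?f S) = ?g (?f T)" by simp
      then show False
        unfolding mult_recover[OF assms that(1)] mult_recover[OF assms that(2)] using that(3) by simp
    qed
    moreover have "?f S \<subseteq> ?f T" using that(3) by (intro plus_mono image_mono) simp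
    ultimately show ?thesis by simp
  qed
  have g_strict: "?g S \<subset> ?g T" if "S \<in> ?L'" "T \<in> ?L'" "S \<subset> T" for S T
  proof -
    have "?g S \<noteq> ?g T"
    proof
      assume "?g S = ?g T"
      then have "?f (?g S) = ?f (?g T)" by simp
      then show False
        unfolding mult_recover_target[OF assms that(1)] mult_recover_target[OF assms that(2)] using that(3) by simp
    qed
    then show ?thesis using that(3) by blast
  qed
  show "len k ?K P \<le> len (Suc k) N ?I"
    by (rule height_leI[OF K], rule le_height[OF finite_seg], erule chain_lengths_image[where f = ?f])
      (fact f f_strict)+
  show "len (Suc k) N ?I \<le> len k ?K P"
    by (rule height_leI[OF N'], rule le_height[OF finite_seg], erule chain_lengths_image[where f = ?g])
      (fact g g_strict)+
qed

end

text \<open>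
  Eventually \<open>P (Suc k)\<close> is the submodule generated by the images \<open>x j k ` P k\<close>; quantifying over all
  submodules \<open>B\<close> above those images avoids naming it.
\<close>
locale noetherian_sequence = finite_length_sequence +
  assumes finite_J: "finite J"
    and noetherian: "Graded_Sub P \<Longrightarrow> \<exists>K. \<forall>k\<ge>K. \<forall>B\<in>Sub (Suc k). (\<forall>j\<in>J. x j k ` P k \<subseteq> B) \<longrightarrow> P (Suc k) \<subseteq> B"
begin

lemma Graded_SubD: "Graded_Sub P \<Longrightarrow> P k \<in> Sub k" "Graded_Sub P \<Longrightarrow> j \<in> J \<Longrightarrow> f \<in> P k \<Longrightarrow> x j k f \<in> P (Suc k)"
  unfolding Graded_Sub_def by auto

text \<open>
  The induction on the number of operators that act nontrivially runs through subquotients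
  \<open>P / N\<close> of the fixed sequence: multiplication by the next operator \<open>y\<close> on \<open>P / N\<close> has kernel
  \<open>K / N\<close> and cokernel \<open>P / L\<close>, both annihilated by \<open>y\<close>.
\<close>
lemma hilbert_serre_subquotient:
  assumes "I \<subseteq> J" "Graded_Sub N" "Graded_Sub P" "\<And>k. N k \<subseteq> P k"
    and "\<And>j k. j \<in> J - I \<Longrightarrow> x j k ` P k \<subseteq> N (Suc k)"
  shows "eventually_poly (\<lambda>k. of_nat (len k (N k) (P k)) :: 'f::field_char_0)"
  using finite_subset[OF assms(1) finite_J] assms
proof (induction I arbitrary: N P rule: finite_induct)
  case empty
  obtain K where K: "\<forall>k\<ge>K. \<forall>B\<in>Sub (Suc k). (\<forall>j\<in>J. x j k ` P k \<subseteq> B) \<longrightarrow> P (Suc k) \<subseteq> B"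
    by (rule exE[OF noetherian[OF empty(3)]])
  \<comment> \<open>All operators send P into N, so for large \<open>k\<close> the submodule
    \<open>N k\<close> contains every image and, by \<open>noetherian\<close>, all of
    \<open>P k\<close>.\<close>
  have "len k (N k) (P k) = 0" if k: "k \<ge> Suc K" for k
  proof -
    obtain k' where k': "k = Suc k'" "k' \<ge> K" using k by (cases k) auto
    have "\<forall>j\<in>J. x j k' ` P k' \<subseteq> N k" using empty(5)[of _ k'] k' by simp
    then have "P k \<subseteq> N k" using K k' Graded_SubD(1)[OF empty(2), of k] by simp
    then have "P k = N k" using empty(4)[of k] by simp
    then have "seg (Sub k) (N k) (P k) = {N k}"
      using Graded_SubD(1)[OF empty(2), of k] unfolding seg_def by auto
    \<comment> \<open>Additivity on N <= N <= N reads a = a + a, which forces a = 0.\<close>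
    then show ?thesis using len_add[of "N k" k "N k" "N k"] Graded_SubD(1)[OF empty(2), of k] \<open>P k = N k\<close> by auto
  qed
  then have "\<forall>k\<ge>Suc K. poly 0 (of_nat k) = (of_nat (len k (N k) (P k)) :: 'f)" by simp
  then show ?case unfolding eventually_poly_def eventually_sequentially by blast
next
  case (insert y I)
  have y: "y \<in> J" using insert by auto
  note N = Graded_SubD[OF insert(5)] and P = Graded_SubD[OF insert(6)]
  define K where "K k = {p \<in> P k. x y k p \<in> N (Suc k)}" for k
  \<comment> \<open>This is y P + N, which sits one degree higher than the P it is made from. In
    degree 0 nothing arrives from below, so only N remains.\<close>
  define L where "L k = (case k of 0 \<Rightarrow> N 0 | Suc k' \<Rightarrow> plus (x y k' ` P k') (N (Suc k')))" for k
  have L_Suc: "L (Suc k) = plus (x y k ` P k) (N (Suc k))" for k by (simp add: L_def)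
  have L_Sub: "L k \<in> Sub k" for k
    using N(1) plus_in_Sub[OF image_in_Sub[OF y P(1)] N(1)] by (cases k) (auto simp: L_def)
  have N_L: "N k \<subseteq> L k" for k
    using plus_upper(2)[OF image_in_Sub[OF y P(1)] N(1)] by (cases k) (auto simp: L_def)
  have L_P: "L k \<subseteq> P k" for k
  proof (cases k)
    case (Suc k')
    show ?thesis unfolding Suc L_Suc
      by (rule plus_least[OF _ _ P(1)]) (use insert(7) P(2)[OF y] in auto)
  qed (use insert(7) in \<open>auto simp: L_def\<close>)
  have N_K: "N k \<subseteq> K k" for k unfolding K_def using insert(7) N(2)[OF y] by auto
  have K_P: "K k \<subseteq> P k" for k unfolding K_def by auto
  have K_Sub: "K k \<in> Sub k" for k unfolding K_def by (rule preimage_in_Sub[OF y P(1) N(1)])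
  \<comment> \<open>Since the operators commute, both the kernel and the image of y are stable under
    all of them.\<close>
  have GK: "Graded_Sub K"
    unfolding Graded_Sub_def
  proof (safe, rule K_Sub)
    fix k j p assume j: "j \<in> J" and p: "p \<in> K k"
    then have "x y (Suc k) (x j k p) = x j (Suc k) (x y k p)"
      using x_commute[OF y j] SubD(2)[OF K_Sub] by auto
    then show "x j k p \<in> K (Suc k)" using p P(2)[OF j] N(2)[OF j] by (auto simp: K_def)
  qed
  have GL: "Graded_Sub L"
    unfolding Graded_Sub_def
  proof (safe, rule L_Sub)
    fix k j l assume j: "j \<in> J" and l: "l \<in> L k"
    show "x j k l \<in> L (Suc k)"
    proof (cases k)
      case 0
      then have "x j k l \<in> N (Suc k)" using l N(2)[OF j] by (auto simp: L_def)
      then show ?thesis using N_L by auto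
    next
      case (Suc k')
      then obtain p n where pn: "p \<in> P k'" "n \<in> N k" "l = add (x y k' p) n"
        using l by (auto simp: L_def plus_def)
      have mem: "p \<in> M k'" "n \<in> M k" using pn SubD(2)[OF P(1)] SubD(2)[OF N(1)] by auto
      then have "x j k l = add (x j k (x y k' p)) (x j k n)"
        using pn x_add[OF j] x_closed[OF y] Suc by auto
      also have "x j k (x y k' p) = x y k (x j k' p)"
        using x_commute[OF j y mem(1)] Suc by simp
      finally have "x j k l = add (x y k (x j k' p)) (x j k n)" .
      moreover have "x j k' p \<in> P k" using P(2)[OF j pn(1)] Suc by simp
      moreover have "x j k n \<in> N (Suc k)" by (rule N(2)[OF j pn(2)])
      ultimately show ?thesis unfolding L_Suc plus_def by blast
    qed
  qed
  have IK: "eventually_poly (\<lambda>k. of_nat (len k (N k) (K k)) :: 'f)"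
  proof (rule insert.IH[OF _ insert(5) GK N_K])
    show "I \<subseteq> J" using insert by auto
    show "x j k ` K k \<subseteq> N (Suc k)" if "j \<in> J - I" for j k
      using that insert(8)[of j k] by (cases "j = y") (auto simp: K_def)
  qed
  have "eventually_poly (\<lambda>k. of_nat (len k (L k) (P k)) :: 'f)"
  proof (rule insert.IH[OF _ GL insert(6) L_P])
    show "I \<subseteq> J" using insert by auto
    show "x j k ` P k \<subseteq> L (Suc k)" if "j \<in> J - I" for j k
    proof (cases "j = y")
      case True
      then show ?thesis
        unfolding L_Suc using plus_upper(1)[OF image_in_Sub[OF y P(1)] N(1)] by auto
    next
      case False
      then show ?thesis using that insert(8)[of j k] N_L[of "Suc k"] by auto
    qed
  qed
  then have IL: "eventually_poly (\<lambda>k. of_nat (len (k + 1) (L (k + 1)) (P (k + 1))) :: 'f)"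
    by (subst eventually_poly_offset)
  \<comment> \<open>Additivity along the exact sequence 0 -> K / N -> P / N -> P / N -> P / L -> 0,
    whose middle map is y. The last two terms are taken in degree k + 1, so the lengths of P / N
    enter as an increment in k.\<close>
  have "len (Suc k) (N (Suc k)) (P (Suc k)) + len k (N k) (K k) =
      len k (N k) (P k) + len (Suc k) (L (Suc k)) (P (Suc k))" for k
  proof -
    have "len k (N k) (P k) = len k (N k) (K k) + len k (K k) (P k)"
      by (intro len_add N(1) K_Sub P(1) N_K K_P)
    moreover have "len (Suc k) (N (Suc k)) (P (Suc k)) =
        len (Suc k) (N (Suc k)) (L (Suc k)) + len (Suc k) (L (Suc k)) (P (Suc k))"
      by (intro len_add N(1) L_Sub P(1) N_L L_P)
    moreover have "len k (K k) (P k) = len (Suc k) (N (Suc k)) (L (Suc k))"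
      unfolding K_def L_Suc by (rule len_mult[OF y P(1) N(1)])
    ultimately show ?thesis by simp
  qed
  then have eq: "of_nat (len (Suc k) (N (Suc k)) (P (Suc k))) + of_nat (len k (N k) (K k)) =
      (of_nat (len k (N k) (P k)) + of_nat (len (Suc k) (L (Suc k)) (P (Suc k))) :: 'f)" for k
    unfolding of_nat_add[symmetric] by (rule arg_cong)
  have diff: "of_nat (len (Suc k) (N (Suc k)) (P (Suc k))) - of_nat (len k (N k) (P k)) =
      (of_nat (len (k + 1) (L (k + 1)) (P (k + 1))) - of_nat (len k (N k) (K k)) :: 'f)" for k
  proof -
    have swap: "a - c = b - h" if "a + h = c + b" for a b c h :: 'f
    proof -
      have "a = c + b - h" using that by (simp add: eq_diff_eq)
      then show ?thesis by simp
    qed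
    show ?thesis unfolding Suc_eq_plus1[symmetric] by (rule swap[OF eq])
  qed
  show ?case
    by (rule eventually_poly_step, unfold diff, rule eventually_poly_diff[OF IL IK])
qed

theorem hilbert_serre:
  "eventually_poly (\<lambda>k. of_nat (height (Sub k)) :: 'f::field_char_0)"
proof -
  have "eventually_poly (\<lambda>k. of_nat (len k {zero k} (M k)) :: 'f)"
    \<comment> \<open>The induction starts from P / 0 with all of \<open>J\<close> allowed to act,
      so no operator has to be shown to vanish.\<close>
    by (rule hilbert_serre_subquotient[of J])
      (auto simp: Graded_Sub_def M_in_Sub zero_in_Sub x_zero x_closed zero_closed)
  moreover have "seg (Sub k) {zero k} (M k) = Sub k" for k
    unfolding seg_def using SubD by auto
  ultimately show ?thesis by simp
qed

end

section \<open>Graded Noetherian rings\<close>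

text \<open>\<open>graded_ring\<close> states uniqueness for sums over the exact support. Here two
  families are compared over a common finite index set on which terms may be zero.\<close>

lemma graded_ring_unique:
  assumes gr: "graded_ring Rg" and S: "finite S"
    and c: "\<And>k. c k \<in> Rg k" "\<And>k. k \<notin> S \<Longrightarrow> c k = 0"
    and c': "\<And>k. c' k \<in> Rg k" "\<And>k. k \<notin> S \<Longrightarrow> c' k = 0"
    and eq: "sum c S = sum c' S"
  shows "c k = c' k"
proof -
  have *: "finite {k. b k \<noteq> 0}" "sum b S = sum b {k. b k \<noteq> 0}" if "\<And>k. k \<notin> S \<Longrightarrow> b k = 0" for b
  proof -
    have sub: "{k. b k \<noteq> 0} \<subseteq> S" using that by auto
    show "finite {k. b k \<noteq> 0}" by (rule finite_subset[OF sub S])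
    show "sum b S = sum b {k. b k \<noteq> 0}"
      by (rule sum.mono_neutral_right[OF S sub]) auto
  qed
  have "\<exists>!b. finite {k. b k \<noteq> 0} \<and> (\<forall>k. b k \<in> Rg k) \<and> sum c S = sum b {k. b k \<noteq> 0}"
    using gr unfolding graded_ring_def by blast
  then have "c = c'" using *[of c] *[of c'] c c' eq by metis
  then show ?thesis by simp
qed

lemma graded_ring_decompose:
  assumes "graded_ring Rg"
  shows "\<exists>c N. (\<forall>k. c k \<in> Rg k) \<and> (\<forall>k\<ge>N. c k = 0) \<and> r = (\<Sum>k<N. c k)"
proof -
  obtain c where c: "finite {k. c k \<noteq> 0}" "\<forall>k. c k \<in> Rg k" "r = sum c {k. c k \<noteq> 0}"
    using assms unfolding graded_ring_def by metis
  obtain N where N: "{k. c k \<noteq> 0} \<subseteq> {..<N}" using c(1) finite_nat_bounded by blast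
  have "sum c {..<N} = sum c {k. c k \<noteq> 0}"
    by (rule sum.mono_neutral_right[OF _ N]) auto
  moreover have "\<forall>k\<ge>N. c k = 0" using N by force
  ultimately show ?thesis using c by metis
qed

lemma graded_ringD:
  assumes "graded_ring Rg"
  shows "0 \<in> Rg n" "a \<in> Rg n \<Longrightarrow> b \<in> Rg n \<Longrightarrow> a + b \<in> Rg n" "a \<in> Rg n \<Longrightarrow> - a \<in> Rg n"
    "1 \<in> Rg 0" "a \<in> Rg m \<Longrightarrow> b \<in> Rg n \<Longrightarrow> a * b \<in> Rg (m + n)"
  using assms unfolding graded_ring_def by blast+

lemma graded_ring_sum:
  assumes "graded_ring Rg" "\<And>i. i \<in> I \<Longrightarrow> f i \<in> Rg n"
  shows "sum f I \<in> Rg n"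
  using assms(2) by (induction I rule: infinite_finite_induct) (auto intro: graded_ringD[OF assms(1)])

text \<open>All elements of \<open>F\<close> have degree \<open>d\<close>, so only the degree-0
  parts of the coefficients contribute to the degree-\<open>d\<close> component of the sum.\<close>

lemma homogeneous_coefficients:
  assumes gr: "graded_ring Rg" and F: "finite F" "F \<subseteq> Rg d"
    and r: "r \<in> Rg d" "r = (\<Sum>a\<in>F. c a * a)"
  shows "\<exists>c0. (\<forall>a. c0 a \<in> Rg 0) \<and> r = (\<Sum>a\<in>F. c0 a * a)"
proof -
  have "\<exists>b N. (\<forall>k. b k \<in> Rg k) \<and> (\<forall>k\<ge>N. b k = 0) \<and> c a = (\<Sum>k<N. b k)" for a
    by (rule graded_ring_decompose[OF gr])
  then obtain b N where b: "\<And>a k. b a k \<in> Rg k" "\<And>a k. k \<ge> N a \<Longrightarrow> b a k = 0"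
    "\<And>a. c a = (\<Sum>k<N a. b a k)"
    by metis
  \<comment> \<open>A common bound for the components of all coefficients. The successor keeps it
    positive, so that the index \<open>d\<close> lies in \<open>{..<d + N0}\<close> even if
    \<open>F\<close> is empty.\<close>
  define N0 where "N0 = Suc (Max (insert 0 (N ` F)))"
  have N0: "N a \<le> N0" if "a \<in> F" for a
    unfolding N0_def using that F(1) by (intro le_SucI Max_ge) auto
  have c: "c a = (\<Sum>k<N0. b a k)" if "a \<in> F" for a
    unfolding b(3) by (rule sum.mono_neutral_left) (use N0[OF that] b(2) in auto)
  \<comment> \<open>The degree-\<open>j\<close> component of the sum. Below \<open>d\<close> it is
    0, and the case split guards against the truncated subtraction \<open>j - d\<close>.\<close>
  define u where "u j = (if j < d then 0 else \<Sum>a\<in>F. b a (j - d) * a)" for j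
  have u: "u j \<in> Rg j" for j
  proof (cases "j < d")
    case False
    then have "b a (j - d) * a \<in> Rg j" if "a \<in> F" for a
      using graded_ringD(5)[OF gr b(1), of a d a "j - d"] that F by auto
    then show ?thesis unfolding u_def using False by (auto intro: graded_ring_sum[OF gr])
  qed (auto simp: u_def graded_ringD[OF gr])
  have "u d = (if d = d then r else 0)"
  proof (rule graded_ring_unique[OF gr, where S = "{..<d + N0}" and c = u
        and c' = "\<lambda>j. if j = d then r else 0"])
    show "u k = 0" if "k \<notin> {..<d + N0}" for k
    proof -
      have "b a (k - d) = 0" if "a \<in> F" for a
        using b(2)[of a "k - d"] N0[OF that] \<open>k \<notin> {..<d + N0}\<close> by simp
      then show ?thesis by (simp add: u_def)
    qed
    have "sum u {..<d + N0} = sum u {d..<d + N0}"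
      by (rule sum.mono_neutral_right) (auto simp: u_def)
    also have "\<dots> = (\<Sum>k<N0. u (k + d))"
      using sum.shift_bounds_nat_ivl[of u 0 d N0] by (simp add: add.commute atLeast0LessThan)
    also have "\<dots> = (\<Sum>a\<in>F. \<Sum>k<N0. b a k * a)"
      by (simp add: u_def sum.swap[of _ F])
    also have "\<dots> = r" unfolding r(2) by (simp add: c sum_distrib_right)
    also have "\<dots> = (\<Sum>j<d + N0. if j = d then r else 0)" by (simp add: N0_def)
    finally show "sum u {..<d + N0} = (\<Sum>j<d + N0. if j = d then r else 0)" .
    show "\<And>k. k \<notin> {..<d + N0} \<Longrightarrow> (if k = d then r else 0) = 0" by (auto simp: N0_def)
  qed (use u r graded_ringD[OF gr] in auto)
  then have "r = (\<Sum>a\<in>F. b a 0 * a)" by (simp add: u_def)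
  with b(1) show ?thesis by (intro exI[of _ "\<lambda>a. b a 0"]) simp
qed

text \<open>The ideal generated by \<open>Rg d\<close> is finitely generated, and each of its
  generators involves only finitely many elements of \<open>Rg d\<close>. Collecting these and
  comparing degrees shows that they generate \<open>Rg d\<close> over \<open>Rg 0\<close>.\<close>

lemma finitely_many_generators:
  fixes Rg :: "nat \<Rightarrow> 'r::comm_ring_1 set"
  assumes gr: "graded_ring Rg" and noeth: "noetherian_ring TYPE('r)"
  shows "\<exists>F. finite F \<and> F \<subseteq> Rg d \<and> (\<forall>r\<in>Rg d. \<exists>c. (\<forall>a. c a \<in> Rg 0) \<and> r = (\<Sum>a\<in>F. c a * a))"
proof -
  define I where "I = {r. \<exists>F c. finite F \<and> F \<subseteq> Rg d \<and> r = (\<Sum>a\<in>F. c a * a)}"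
  have I_I: "(\<Sum>a\<in>F. c a * a) \<in> I" if "finite F" "F \<subseteq> Rg d" for F and c :: "'r \<Rightarrow> 'r"
    unfolding I_def using that by (intro CollectI exI[of _ F] exI[of _ c]) simp
  have extend: "(\<Sum>a\<in>F. c a * a) = (\<Sum>a\<in>E. (if a \<in> F then c a else 0) * a)"
    if "finite E" "F \<subseteq> E" for E F and c :: "'r \<Rightarrow> 'r"
    by (rule sum.mono_neutral_cong_left) (use that in auto)
  have "is_ideal I"
    unfolding is_ideal_def
  proof (intro conjI ballI allI)
    show "0 \<in> I" using I_I[of "{}"] by simp
  next
    fix a b assume "a \<in> I" "b \<in> I"
    then obtain E c F c' where *: "finite E" "E \<subseteq> Rg d" "a = (\<Sum>a\<in>E. c a * a)"
      "finite F" "F \<subseteq> Rg d" "b = (\<Sum>a\<in>F. c' a * a)"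
      unfolding I_def by auto
    have "a + b = (\<Sum>x\<in>E \<union> F. ((if x \<in> E then c x else 0) + (if x \<in> F then c' x else 0)) * x)"
    proof -
      have "a = (\<Sum>x\<in>E \<union> F. (if x \<in> E then c x else 0) * x)"
        unfolding *(3) by (rule extend) (use * in auto)
      moreover have "b = (\<Sum>x\<in>E \<union> F. (if x \<in> F then c' x else 0) * x)"
        unfolding *(6) by (rule extend) (use * in auto)
      ultimately show ?thesis by (simp only: distrib_right sum.distrib)
    qed
    moreover have "finite (E \<union> F)" "E \<union> F \<subseteq> Rg d" using * by auto
    ultimately show "a + b \<in> I"
      using I_I[of "E \<union> F" "\<lambda>x. (if x \<in> E then c x else 0) + (if x \<in> F then c' x else 0)"] by metis
  next
    fix r a assume "a \<in> I"
    then obtain E c where *: "finite E" "E \<subseteq> Rg d" "a = (\<Sum>a\<in>E. c a * a)"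
      unfolding I_def by auto
    then have "r * a = (\<Sum>a\<in>E. (r * c a) * a)" by (simp add: sum_distrib_left mult.assoc)
    with I_I[OF *(1,2), of "\<lambda>a. r * c a"] show "r * a \<in> I" by simp
  qed
  then obtain G where G: "finite G" "G \<subseteq> I" "I = {(\<Sum>f\<in>G. c f * f) | c. True}"
    using noeth[unfolded noetherian_ring_def, rule_format, of I] by blast
  have "\<forall>g\<in>G. \<exists>F c. finite F \<and> F \<subseteq> Rg d \<and> g = (\<Sum>a\<in>F. c a * a)"
    using G(2) unfolding I_def by auto
  then obtain F c where Fc: "\<And>g. g \<in> G \<Longrightarrow> finite (F g) \<and> F g \<subseteq> Rg d \<and> g = (\<Sum>a\<in>F g. c g a * a)"
    by metis
  define E where "E = (\<Union>g\<in>G. F g)"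
  have E: "finite E" "E \<subseteq> Rg d" unfolding E_def using G(1) Fc by auto
  show ?thesis
  proof (intro exI[of _ E] conjI E ballI)
    fix r assume r: "r \<in> Rg d"
    then have "r \<in> I" using I_I[of "{r}" "\<lambda>_. 1"] by simp
    then obtain b where b: "r = (\<Sum>g\<in>G. b g * g)" using G(3) by auto
    have g: "g = (\<Sum>a\<in>E. (if a \<in> F g then c g a else 0) * a)" if "g \<in> G" for g
    proof -
      have "g = (\<Sum>a\<in>F g. c g a * a)" using Fc[OF that] by blast
      also have "\<dots> = (\<Sum>a\<in>E. (if a \<in> F g then c g a else 0) * a)"
        by (rule extend[OF E(1)]) (use that in \<open>auto simp: E_def\<close>)
      finally show ?thesis .
    qed
    have "r = (\<Sum>g\<in>G. b g * (\<Sum>a\<in>E. (if a \<in> F g then c g a else 0) * a))"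
      unfolding b by (rule sum.cong[OF refl]) (rule arg_cong[OF g])
    also have "\<dots> = (\<Sum>a\<in>E. \<Sum>g\<in>G. b g * ((if a \<in> F g then c g a else 0) * a))"
      unfolding sum_distrib_left by (rule sum.swap)
    also have "\<dots> = (\<Sum>a\<in>E. (\<Sum>g\<in>G. b g * (if a \<in> F g then c g a else 0)) * a)"
      by (simp only: sum_distrib_right mult.assoc)
    finally show "\<exists>c. (\<forall>a. c a \<in> Rg 0) \<and> r = (\<Sum>a\<in>E. c a * a)"
      by (rule homogeneous_coefficients[OF gr E r])
  qed
qed

text \<open>Extends the factorization in \<open>generated_in_degree\<close>, stated for exponents k
  >= 1, to degree \<open>d\<close> itself through r = r * 1.\<close>

lemma generated_in_degree_decompose:
  fixes Rg :: "nat \<Rightarrow> 'r::comm_ring_1 set"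
  assumes "graded_ring Rg" "generated_in_degree Rg d" "r \<in> Rg (d * Suc q)"
  obtains a b :: "nat \<Rightarrow> 'r" and N where "\<forall>j<N. a j \<in> Rg d \<and> b j \<in> Rg (d * q)" "r = (\<Sum>j<N. a j * b j)"
proof (cases "q = 0")
  case True
  then show ?thesis using assms graded_ringD(4)[OF assms(1)]
    by (intro that[of 1 "\<lambda>_. r" "\<lambda>_. 1"]) auto
next
  case False
  then have "1 \<le> q" by simp
  with assms(2,3) have "\<exists>(a::nat \<Rightarrow> 'r) b N. (\<forall>j<N. a j \<in> Rg d \<and> b j \<in> Rg (d * q)) \<and> r = (\<Sum>j<N. a j * b j)"
    unfolding generated_in_degree_def Suc_eq_plus1 by blast
  then show ?thesis by (elim exE conjE) (rule that)
qed

section \<open>Graded Hom modules\<close>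

text \<open>The definition branches at 0; on the negative side one suspension cancels one
  inverse.\<close>

lemma SigPowO_Suc:
  assumes "bij (SigO C)"
  shows "SigPowO C (n + 1) Z = SigO C (SigPowO C n Z)"
proof (cases "n \<ge> 0")
  case True
  then have "nat (n + 1) = Suc (nat n)" by simp
  with True show ?thesis by (simp add: SigPowO_def)
next
  case False
  define k where "k = nat (- (n + 1))"
  have "nat (- n) = Suc k" "n + 1 = - int k" using False unfolding k_def by auto
  moreover have "SigO C (inv (SigO C) z) = z" for z using assms by (simp add: bij_is_surj surj_f_inv_f)
  ultimately show ?thesis using False by (simp add: SigPowO_def)
qed

lemma SigPowO_add:
  assumes "bij (SigO C)"
  shows "SigPowO C (int m) (SigPowO C n Z) = SigPowO C (n + int m) Z"
proof (induction m)
  case 0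
  show ?case by (simp add: SigPowO_def)
next
  case (Suc m)
  have "SigPowO C (int (Suc m)) (SigPowO C n Z) = SigO C (SigPowO C (int m) (SigPowO C n Z))"
    using SigPowO_Suc[OF assms, of "int m"] by (simp add: add.commute)
  also have "\<dots> = SigPowO C (n + int m + 1) Z"
    unfolding Suc by (rule SigPowO_Suc[OF assms, symmetric])
  also have "n + int m + 1 = n + int (Suc m)" by simp
  finally show ?case .
qed

locale linear_triangulated =
  fixes C :: "('o,'m) tcat" and Rg :: "nat \<Rightarrow> 'r::comm_ring_1 set"
    and phi :: "nat \<Rightarrow> 'r \<Rightarrow> 'o \<Rightarrow> 'm" and d :: nat and X Y :: 'o
  assumes standing: "standing_ring Rg d"
    and triangulated: "is_triangulated C"
    and linear: "r_linear C Rg phi"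
begin

lemma graded: "graded_ring Rg" and generated: "generated_in_degree Rg d"
  and ring_noetherian: "noetherian_ring TYPE('r)" and d_ge: "d \<ge> 2"
  using standing unfolding standing_ring_def by auto

lemma preadditive: "is_preadditive C"
  using triangulated unfolding is_triangulated_def is_additive_def by blast

lemma category: "is_category C"
  using preadditive unfolding is_preadditive_def by blast

lemma bij_SigO: "bij (SigO C)"
  using triangulated unfolding is_triangulated_def is_susp_def by blast

lemmas SigPow_add = SigPowO_add[OF bij_SigO]

lemma Comp_closed: "f \<in> tHom C U V \<Longrightarrow> g \<in> tHom C V W \<Longrightarrow> Comp C g f \<in> tHom C U W"
  using category unfolding is_category_def tHom_def by auto

lemma Comp_assoc:
  "f \<in> tHom C U V \<Longrightarrow> g \<in> tHom C V W \<Longrightarrow> h \<in> tHom C W Z \<Longrightarrow>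
    Comp C h (Comp C g f) = Comp C (Comp C h g) f"
  using category unfolding is_category_def tHom_def by auto

lemma Comp_id: "f \<in> tHom C U V \<Longrightarrow> Comp C (Idm C V) f = f"
  using category unfolding is_category_def tHom_def by auto

lemma Zer_closed: "Zer C U V \<in> tHom C U V"
  and Add_closed: "f \<in> tHom C U V \<Longrightarrow> g \<in> tHom C U V \<Longrightarrow> Add C f g \<in> tHom C U V"
  and Add_assoc: "f \<in> tHom C U V \<Longrightarrow> g \<in> tHom C U V \<Longrightarrow> h \<in> tHom C U V \<Longrightarrow>
    Add C (Add C f g) h = Add C f (Add C g h)"
  and Add_commute: "f \<in> tHom C U V \<Longrightarrow> g \<in> tHom C U V \<Longrightarrow> Add C f g = Add C g f"
  and Add_Zer: "f \<in> tHom C U V \<Longrightarrow> Add C f (Zer C U V) = f"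
  and Neg_closed: "f \<in> tHom C U V \<Longrightarrow> Neg C f \<in> tHom C U V"
  and Add_Neg: "f \<in> tHom C U V \<Longrightarrow> Add C f (Neg C f) = Zer C U V"
  by (use preadditive[unfolded is_preadditive_def, THEN conjunct2, THEN conjunct1,
        THEN spec, THEN spec, of U V] in \<open>blast+\<close>)

lemma Comp_Add_right: "f \<in> tHom C U V \<Longrightarrow> g \<in> tHom C U V \<Longrightarrow> h \<in> tHom C V W \<Longrightarrow>
    Comp C h (Add C f g) = Add C (Comp C h f) (Comp C h g)"
  and Comp_Add_left: "f \<in> tHom C U V \<Longrightarrow> g \<in> tHom C V W \<Longrightarrow> h \<in> tHom C V W \<Longrightarrow>
    Comp C (Add C g h) f = Add C (Comp C g f) (Comp C h f)"
  using preadditive[unfolded is_preadditive_def, THEN conjunct2, THEN conjunct2] by auto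

lemma idem_Zer:
  assumes "f \<in> tHom C U V" "Add C f f = f"
  shows "f = Zer C U V"
  using Add_assoc[OF assms(1,1) Neg_closed[OF assms(1)]] Add_Neg[OF assms(1)] Add_Zer[OF assms(1)]
    assms(2) by simp

lemma phi_closed: "r \<in> Rg m \<Longrightarrow> phi m r Z \<in> tHom C Z (SigPowO C (int m) Z)"
  and phi_natural: "r \<in> Rg m \<Longrightarrow> f \<in> tHom C U V \<Longrightarrow>
    Comp C (SigPowM C (int m) f) (phi m r U) = Comp C (phi m r V) f"
  and phi_add: "r \<in> Rg m \<Longrightarrow> s \<in> Rg m \<Longrightarrow> phi m (r + s) Z = Add C (phi m r Z) (phi m s Z)"
  and phi_mult: "r \<in> Rg m \<Longrightarrow> s \<in> Rg n \<Longrightarrow>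
    phi (m + n) (r * s) Z = Comp C (SigPowM C (int m) (phi n s Z)) (phi m r Z)"
  and phi_one: "phi 0 1 Z = Idm C Z"
  using linear unfolding r_linear_def central_elt_def tHom_def by auto

abbreviation H :: "int \<Rightarrow> 'm set" where
  "H n \<equiv> tHom C X (SigPowO C n Y)"

abbreviation zer :: "int \<Rightarrow> 'm" where
  "zer n \<equiv> Zer C X (SigPowO C n Y)"

definition act :: "nat \<Rightarrow> 'r \<Rightarrow> int \<Rightarrow> 'm \<Rightarrow> 'm" where
  "act m r n f = Comp C (phi m r (SigPowO C n Y)) f"

lemma phi_closed': "r \<in> Rg m \<Longrightarrow> phi m r (SigPowO C n Z) \<in> tHom C (SigPowO C n Z) (SigPowO C (n + int m) Z)"
  using phi_closed[of r m "SigPowO C n Z"] by (simp add: SigPow_add)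

lemma graded_act_closed: "r \<in> Rg m \<Longrightarrow> f \<in> H n \<Longrightarrow> act m r n f \<in> H (n + int m)"
  unfolding act_def by (rule Comp_closed[OF _ phi_closed'])

lemma act_add_right: "r \<in> Rg m \<Longrightarrow> f \<in> H n \<Longrightarrow> g \<in> H n \<Longrightarrow>
    act m r n (Add C f g) = Add C (act m r n f) (act m r n g)"
  unfolding act_def by (rule Comp_Add_right[OF _ _ phi_closed'])

lemma act_add_left: "r \<in> Rg m \<Longrightarrow> s \<in> Rg m \<Longrightarrow> f \<in> H n \<Longrightarrow>
    act m (r + s) n f = Add C (act m r n f) (act m s n f)"
  unfolding act_def phi_add by (rule Comp_Add_left[OF _ phi_closed' phi_closed'])

text \<open>The product rule of \<open>r_linear\<close> involves a suspended factor. Naturality of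
  \<open>phi k s\<close> along \<open>phi m r\<close> replaces it by \<open>phi k s\<close> at the
  shifted object, so products act by composition; commutativity of the ring settles the order of the
  factors.\<close>

lemma act_act:
  assumes r: "r \<in> Rg m" and s: "s \<in> Rg k" and f: "f \<in> H n"
  shows "act k s (n + int m) (act m r n f) = act (m + k) (r * s) n f"
proof -
  let ?Z = "SigPowO C n Y"
  have "phi (m + k) (r * s) ?Z = Comp C (phi m r (SigPowO C (n + int k) Y)) (phi k s ?Z)"
    unfolding phi_mult[OF r s] by (rule phi_natural[OF r phi_closed'[OF s]])
  moreover have "phi (k + m) (s * r) ?Z = Comp C (phi k s (SigPowO C (n + int m) Y)) (phi m r ?Z)"
    unfolding phi_mult[OF s r] by (rule phi_natural[OF s phi_closed'[OF r]])
  ultimately show ?thesis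
    unfolding act_def using Comp_assoc[OF f phi_closed'[OF r] phi_closed'[OF s]]
    by (simp add: add.commute mult.commute)
qed

lemma act_one: "f \<in> H n \<Longrightarrow> act 0 1 n f = f"
  unfolding act_def phi_one by (rule Comp_id)

lemma act_zer: "r \<in> Rg m \<Longrightarrow> act m r n (zer n) = zer (n + int m)"
  using act_add_right[of r m "zer n" n "zer n"] Add_Zer[OF Zer_closed] Zer_closed
  by (intro idem_Zer graded_act_closed Zer_closed) auto

lemma act_zero_scalar: "f \<in> H n \<Longrightarrow> act m 0 n f = zer (n + int m)"
  using act_add_left[of 0 m 0 f n] graded_ringD(1)[OF graded]
  by (intro idem_Zer graded_act_closed) auto

lemma Add_act_minus_one:
  assumes "f \<in> H n"
  shows "Add C f (act 0 (- 1) n f) = zer n"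
  using act_add_left[of 1 0 "- 1" f n] act_one act_zero_scalar[of f n 0] assms
    graded_ringD(3,4)[OF graded] by simp

lemma act_sum_in:
  assumes "r0_submod C Rg phi X (SigPowO C (n + int m) Y) S" "f \<in> H n" "finite I"
    and "\<And>i. i \<in> I \<Longrightarrow> r i \<in> Rg m \<and> act m (r i) n f \<in> S"
  shows "act m (sum r I) n f \<in> S"
  using assms(3,4)
proof (induction I)
  case empty
  then show ?case using act_zero_scalar[OF assms(2)] assms(1) unfolding r0_submod_def by simp
next
  case (insert i I)
  then have "sum r I \<in> Rg m" by (intro graded_ring_sum[OF graded]) auto
  then have "act m (sum r (insert i I)) n f = Add C (act m (r i) n f) (act m (sum r I) n f)"
    using insert act_add_left[of "r i" m "sum r I" f n] assms(2) by simp
  with insert assms(1) show ?case unfolding r0_submod_def by auto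
qed

end

text \<open>\<open>b\<close> fixes a residue class together with its first degree;
  \<open>b \<ge> n0\<close> keeps the whole progression inside the truncation that
  \<open>noeth_from\<close> controls. \<open>J\<close> is a finite set generating
  \<open>Rg d\<close> over \<open>Rg 0\<close>.\<close>

locale noetherian_hom = linear_triangulated C Rg phi d X Y
  for C :: "('o,'m) tcat" and Rg :: "nat \<Rightarrow> 'r::comm_ring_1 set"
    and phi :: "nat \<Rightarrow> 'r \<Rightarrow> 'o \<Rightarrow> 'm" and d :: nat and X Y :: 'o +
  fixes n0 b :: int and J :: "'r set"
  assumes noeth: "noeth_from C Rg phi X Y n0"
    and fin: "\<And>n. fin_length C Rg phi X (SigPowO C n Y)"
    and b: "b \<ge> n0"
    and J_finite: "finite J" and J_sub: "J \<subseteq> Rg d"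
    and J_gen: "\<And>r. r \<in> Rg d \<Longrightarrow> \<exists>c. (\<forall>a. c a \<in> Rg 0) \<and> r = (\<Sum>a\<in>J. c a * a)"
begin

definition deg :: "nat \<Rightarrow> int" where
  "deg k = b + int d * int k"

lemma deg_Suc: "deg (Suc k) = deg k + int d"
  by (simp add: deg_def algebra_simps)

lemma deg_add: "deg (k + q) = deg k + int (d * q)"
  by (simp add: deg_def algebra_simps)

lemma deg_eq_iff: "deg k = deg l \<longleftrightarrow> k = l"
  using d_ge by (simp add: deg_def)

lemma act_closed_0: "a \<in> Rg 0 \<Longrightarrow> f \<in> H n \<Longrightarrow> act 0 a n f \<in> H n"
  using graded_act_closed[of a 0 f n] by simp

sublocale module_sequence "\<lambda>k. H (deg k)" "Add C" "\<lambda>k. zer (deg k)" "Rg 0"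
  "\<lambda>a k. act 0 a (deg k)" "- 1" J "\<lambda>j k. act d j (deg k)"
proof (unfold_locales, goal_cases)
  case 8
  show ?case using graded_ringD(3,4)[OF graded] by blast
next
  case (10 j f k)
  then show ?case using graded_act_closed[of j d f "deg k"] J_sub by (auto simp: deg_Suc)
next
  case (12 j a f k)
  then show ?case using J_sub act_act[of a 0 j d f "deg k"] act_act[of j d a 0 f "deg k"]
    by (auto simp: deg_Suc mult.commute)
next
  case (13 i j f k)
  then have "i \<in> Rg d" "j \<in> Rg d" using J_sub by auto
  with 13(3) show ?case using act_act[of i d j d f "deg k"] act_act[of j d i d f "deg k"]
    by (simp add: deg_Suc mult.commute)
qed (use Zer_closed Add_closed Add_assoc Add_commute Add_Zer act_closed_0 act_add_right
      graded_ringD(4)[OF graded] Add_act_minus_one J_sub in auto)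

end

context noetherian_hom
begin

lemma Sub_eq: "Sub k = {S. r0_submod C Rg phi X (SigPowO C (deg k) Y) S}"
  unfolding Sub_def r0_submod_def act_def by simp

lemma chain_lengths_Sub: "chain_lengths (Sub k) = {l. r0_chain C Rg phi X (SigPowO C (deg k) Y) l}"
  unfolding chain_lengths_def r0_chain_def Sub_eq by simp

lemma finite_chain_lengths_Sub: "finite (chain_lengths (Sub k))"
  using fin[of "deg k"] unfolding fin_length_def chain_lengths_Sub bdd_above_nat .

lemma lam_eq: "lam C Rg phi X Y (deg k) = height (Sub k)"
  using fin[of "deg k"] unfolding lam_def r0_length_def height_def chain_lengths_Sub by simp

lemma lam_eq_0_iff: "lam C Rg phi X Y (deg k) = 0 \<longleftrightarrow> H (deg k) \<subseteq> {zer (deg k)}"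
proof
  assume lam: "lam C Rg phi X Y (deg k) = 0"
  show "H (deg k) \<subseteq> {zer (deg k)}"
  proof (rule ccontr)
    assume "\<not> H (deg k) \<subseteq> {zer (deg k)}"
    then have "{zer (deg k)} \<subset> H (deg k)" using zero_closed[of k] by auto
    then have "1 \<in> chain_lengths (Sub k)"
      by (intro chain_lengthsI[where c = "\<lambda>i. if i = 0 then {zer (deg k)} else H (deg k)"])
        (auto simp: zero_in_Sub M_in_Sub)
    then show False using le_height[OF finite_chain_lengths_Sub] lam lam_eq by fastforce
  qed
next
  assume H: "H (deg k) \<subseteq> {zer (deg k)}"
  have S: "S = {zer (deg k)}" if "S \<in> Sub k" for S
    using SubD(1,3)[OF that] H by auto
  have "l \<le> 0" if l: "l \<in> chain_lengths (Sub k)" for l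
  proof (rule ccontr)
    assume "\<not> l \<le> 0"
    moreover obtain c where "\<forall>i\<le>l. c i \<in> Sub k" "\<forall>i<l. c i \<subset> c (Suc i)"
      using l unfolding chain_lengths_def by blast
    ultimately have c: "c 0 \<in> Sub k" "c (Suc 0) \<in> Sub k" "c 0 \<subset> c (Suc 0)" by auto
    then show False using S[OF c(1)] S[OF c(2)] by simp
  qed
  then show "lam C Rg phi X Y (deg k) = 0"
    using height_leI[OF M_in_Sub, of k 0] lam_eq by simp
qed

text \<open>Passes from the generators in \<open>J\<close> to all of \<open>Rg d\<close>: a term
  \<open>c a * a\<close> acts as \<open>a\<close> on a scalar multiple of \<open>f\<close>, and that
  multiple is still in \<open>S\<close>.\<close>

lemma step_in:
  assumes r: "r \<in> Rg d" and f: "f \<in> S" and S: "S \<in> Sub k" and B: "B \<in> Sub (Suc k)"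
    and sub: "\<And>j. j \<in> J \<Longrightarrow> act d j (deg k) ` S \<subseteq> B"
  shows "act d r (deg k) f \<in> B"
proof -
  obtain c where c: "\<And>a. c a \<in> Rg 0" "r = (\<Sum>a\<in>J. c a * a)" using J_gen[OF r] by blast
  have fH: "f \<in> H (deg k)" by (rule SubD(2)[OF S f])
  show ?thesis unfolding c(2)
  proof (rule act_sum_in[OF _ fH J_finite])
    show "r0_submod C Rg phi X (SigPowO C (deg k + int d) Y) B"
      using B unfolding Sub_eq deg_Suc by simp
    fix a assume a: "a \<in> J"
    have "act (0 + d) (c a * a) (deg k) f = act d a (deg k) (act 0 (c a) (deg k) f)"
      using act_act[OF c(1) _ fH, of a d a] a J_sub by auto
    also have "\<dots> \<in> B" using sub[OF a] SubD(5)[OF S c(1) f] by auto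
    finally show "c a * a \<in> Rg d \<and> act d (c a * a) (deg k) f \<in> B"
      using graded_ringD(5)[OF graded c(1), of a d a] a J_sub by auto
  qed
qed

text \<open>The factor of degree \<open>d\<close> is made to act last: the rest lands in
  \<open>P (k + q)\<close>, and the final step goes into any \<open>B\<close> above the images.
  Keeping \<open>B\<close> general serves both \<open>power_in\<close>, where it is the next term of
  \<open>P\<close>, and the test submodules of \<open>eventually_generated\<close>.\<close>

lemma power_step_in:
  assumes P: "Graded_Sub P" and IH: "\<And>r. r \<in> Rg (d * q) \<Longrightarrow> act (d * q) r (deg k) f \<in> P (k + q)"
    and r: "r \<in> Rg (d * Suc q)" and f: "f \<in> P k" and B: "B \<in> Sub (Suc (k + q))"
    and sub: "\<And>j. j \<in> J \<Longrightarrow> act d j (deg (k + q)) ` P (k + q) \<subseteq> B"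
  shows "act (d * Suc q) r (deg k) f \<in> B"
proof -
  obtain a b :: "nat \<Rightarrow> 'r" and N where ab: "\<forall>j<N. a j \<in> Rg d \<and> b j \<in> Rg (d * q)" "r = (\<Sum>j<N. a j * b j)"
    by (rule generated_in_degree_decompose[OF graded generated r])
  have P': "P l \<in> Sub l" for l using P unfolding Graded_Sub_def by blast
  have fH: "f \<in> H (deg k)" by (rule SubD(2)[OF P' f])
  show ?thesis unfolding ab(2)
  proof (rule act_sum_in[OF _ fH])
    have "deg (Suc (k + q)) = deg k + int (d * Suc q)" using deg_add[of k "Suc q"] by simp
    then show "r0_submod C Rg phi X (SigPowO C (deg k + int (d * Suc q)) Y) B"
      using B unfolding Sub_eq by simp
    fix j assume "j \<in> {..<N}"
    then have j: "a j \<in> Rg d" "b j \<in> Rg (d * q)" using ab(1) by auto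
    have "act (d * q + d) (b j * a j) (deg k) f = act d (a j) (deg (k + q)) (act (d * q) (b j) (deg k) f)"
      using act_act[OF j(2,1) fH] by (simp add: deg_add)
    also have "\<dots> \<in> B" by (rule step_in[OF j(1) IH[OF j(2)] P' B sub])
    finally show "a j * b j \<in> Rg (d * Suc q) \<and> act (d * Suc q) (a j * b j) (deg k) f \<in> B"
      using graded_ringD(5)[OF graded j] by (simp add: add.commute mult.commute)
  qed simp
qed

lemma power_in:
  assumes P: "Graded_Sub P" and r: "r \<in> Rg (d * q)" and f: "f \<in> P k"
  shows "act (d * q) r (deg k) f \<in> P (k + q)"
  using r
proof (induction q arbitrary: r)
  case 0
  then show ?case using P f unfolding Graded_Sub_def Sub_def by auto
next
  case (Suc q)
  show ?case
    using power_step_in[OF P Suc.IH Suc.prems f, of "P (Suc (k + q))"] P unfolding Graded_Sub_def by simp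
qed

lemma power_Suc_in:
  assumes "Graded_Sub P" "r \<in> Rg (d * Suc q)" "f \<in> P k" "B \<in> Sub (Suc (k + q))"
    and "\<And>j. j \<in> J \<Longrightarrow> act d j (deg (k + q)) ` P (k + q) \<subseteq> B"
  shows "act (d * Suc q) r (deg k) f \<in> B"
  using power_step_in[OF assms(1) _ assms(2-5)] power_in[OF assms(1) _ assms(3)] by blast

text \<open>Turns a graded submodule of one residue class modulo \<open>d\<close> into an \<open>R\<close>-submodule of \<open>Hom\<^sup>*\<close>.\<close>
definition lift :: "(nat \<Rightarrow> 'm set) \<Rightarrow> (int \<Rightarrow> 'm) set" where
  "lift P = {v. homvec C X Y n0 v \<and> (\<forall>k. v (deg k) \<in> P k) \<and> (\<forall>n. n \<notin> range deg \<longrightarrow> v n = zer n)}"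

section \<open>Graded submodules of one residue class as submodules of the full graded Hom
  module\<close>

lemma Rg_eq_zero: "\<not> d dvd m \<Longrightarrow> r \<in> Rg m \<Longrightarrow> r = 0"
  using generated unfolding generated_in_degree_def by auto

lemma hsmult_eq: "hsmult C phi Y m r v n = act m r (n - int m) (v (n - int m))"
  unfolding hsmult_def act_def by simp

lemma homvecD:
  assumes "homvec C X Y n0 v"
  shows "v n \<in> H n" "n < n0 \<Longrightarrow> v n = zer n" "finite {n. v n \<noteq> zer n}"
  using assms unfolding homvec_def by auto

lemma homvec_hsmult:
  assumes v: "homvec C X Y n0 v" and r: "r \<in> Rg m"
  shows "homvec C X Y n0 (hsmult C phi Y m r v)"
proof -
  have z: "hsmult C phi Y m r v n = zer n" if "v (n - int m) = zer (n - int m)" for n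
    using act_zer[OF r, of "n - int m"] that by (simp add: hsmult_eq)
  have "{n. hsmult C phi Y m r v n \<noteq> zer n} \<subseteq> (\<lambda>n. n + int m) ` {n. v n \<noteq> zer n}"
  proof
    fix n assume "n \<in> {n. hsmult C phi Y m r v n \<noteq> zer n}"
    then have "n - int m \<in> {n. v n \<noteq> zer n}" using z by auto
    then show "n \<in> (\<lambda>n. n + int m) ` {n. v n \<noteq> zer n}" by (intro image_eqI[where x = "n - int m"]) auto
  qed
  then have "finite {n. hsmult C phi Y m r v n \<noteq> zer n}"
    using homvecD(3)[OF v] finite_subset by blast
  moreover have "hsmult C phi Y m r v n \<in> H n" for n
    using graded_act_closed[OF r homvecD(1)[OF v], of "n - int m"] by (simp add: hsmult_eq)
  moreover have "hsmult C phi Y m r v n = zer n" if "n < n0" for n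
    by (rule z, rule homvecD(2)[OF v]) (use that in simp)
  ultimately show ?thesis unfolding homvec_def by blast
qed

lemma homvec_vadd:
  assumes v: "homvec C X Y n0 v" and w: "homvec C X Y n0 w"
  shows "homvec C X Y n0 (vadd C v w)"
proof -
  have "{n. vadd C v w n \<noteq> zer n} \<subseteq> {n. v n \<noteq> zer n} \<union> {n. w n \<noteq> zer n}"
    unfolding vadd_def using Add_Zer[OF Zer_closed] by auto
  then have "finite {n. vadd C v w n \<noteq> zer n}"
    using homvecD(3)[OF v] homvecD(3)[OF w] finite_subset by blast
  then show ?thesis
    using homvecD(1,2)[OF v] homvecD(1,2)[OF w] Add_closed Add_Zer[OF Zer_closed]
    unfolding homvec_def vadd_def by auto
qed

text \<open>\<open>Rg m\<close> is zero unless \<open>d\<close> divides \<open>m\<close>, and a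
  lifted vector is zero outside the progression. So a nonzero component of a product can only come
  from a lower or equal term of the same progression.\<close>

lemma hsmult_deg:
  assumes v: "v \<in> lift P" and r: "r \<in> Rg m" and nz: "hsmult C phi Y m r v n \<noteq> zer n"
  obtains q k where "m = d * q" "n = deg (k + q)" "hsmult C phi Y m r v n = act (d * q) r (deg k) (v (deg k))"
proof -
  have hv: "homvec C X Y n0 v" using v unfolding lift_def by blast
  have "d dvd m"
  proof (rule ccontr)
    assume "\<not> d dvd m"
    then have "r = 0" using Rg_eq_zero r by blast
    then show False using nz act_zero_scalar[OF homvecD(1)[OF hv, of "n - int m"], of m] by (simp add: hsmult_eq)
  qed
  then obtain q where q: "m = d * q" by blast
  have "n - int m \<in> range deg"
  proof (rule ccontr)
    assume "n - int m \<notin> range deg"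
    then have "v (n - int m) = zer (n - int m)" using v unfolding lift_def by blast
    then show False using nz act_zer[OF r, of "n - int m"] by (simp add: hsmult_eq)
  qed
  then obtain k where k: "n - int m = deg k" by blast
  then have n: "n = deg k + int m" by simp
  show thesis
    by (rule that[OF q, of k]) (use k n in \<open>simp_all add: deg_add q hsmult_eq\<close>)
qed

lemma lift_submod:
  assumes P: "Graded_Sub P"
  shows "hom_submod C Rg phi X Y n0 (lift P)"
  unfolding hom_submod_def
proof (intro conjI ballI allI)
  have P': "P k \<in> Sub k" for k using P unfolding Graded_Sub_def by blast
  show "lift P \<subseteq> Collect (homvec C X Y n0)" unfolding lift_def by blast
  show "zer \<in> lift P" using SubD(3)[OF P'] Zer_closed unfolding lift_def homvec_def by simp
  show "vadd C v w \<in> lift P" if "v \<in> lift P" "w \<in> lift P" for v w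
    using that homvec_vadd[of v w] SubD(4)[OF P'] Add_Zer[OF Zer_closed] unfolding lift_def
    by (auto simp: vadd_def)
  show "hsmult C phi Y m r v \<in> lift P" if r: "r \<in> Rg m" and v: "v \<in> lift P" for m r v
  proof -
    have "hsmult C phi Y m r v (deg k) \<in> P k" for k
    proof (cases "hsmult C phi Y m r v (deg k) = zer (deg k)")
      case True
      then show ?thesis using SubD(3)[OF P'] by simp
    next
      case False
      then obtain q l where "m = d * q" "deg k = deg (l + q)"
        "hsmult C phi Y m r v (deg k) = act (d * q) r (deg l) (v (deg l))"
        by (rule hsmult_deg[OF v r])
      moreover have "v (deg l) \<in> P l" using v unfolding lift_def by blast
      ultimately show ?thesis using power_in[OF P, of r q "v (deg l)" l] r deg_eq_iff by auto
    qed
    moreover have "hsmult C phi Y m r v n = zer n" if "n \<notin> range deg" for n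
    proof (rule ccontr)
      assume "hsmult C phi Y m r v n \<noteq> zer n"
      then obtain q k where "n = deg (k + q)" by (rule hsmult_deg[OF v r])
      then show False using that by blast
    qed
    moreover have "homvec C X Y n0 (hsmult C phi Y m r v)"
      using v r by (intro homvec_hsmult) (auto simp: lift_def)
    ultimately show ?thesis unfolding lift_def by blast
  qed
qed

text \<open>The lift of P has finitely many generators, each with finite support. Beyond these
  supports every element is obtained by acting with positive degree, whose last step has degree
  \<open>d\<close>, so it lies in each \<open>B\<close> above the images.\<close>

lemma eventually_generated:
  assumes P: "Graded_Sub P"
  shows "\<exists>K. \<forall>k\<ge>K. \<forall>B\<in>Sub (Suc k). (\<forall>j\<in>J. act d j (deg k) ` P k \<subseteq> B) \<longrightarrow> P (Suc k) \<subseteq> B"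
proof -
  have P': "P k \<in> Sub k" for k using P unfolding Graded_Sub_def by blast
  obtain G where G: "finite G" "G \<subseteq> lift P" "lift P = \<Inter>{T. hom_submod C Rg phi X Y n0 T \<and> G \<subseteq> T}"
    using noeth[unfolded noeth_from_def, rule_format, OF lift_submod[OF P]]
    by (elim exE conjE) (rule that)
  have "finite (\<Union>v\<in>G. {n. v n \<noteq> zer n})" using G(1,2) homvecD(3) unfolding lift_def by auto
  then have "finite {k. deg k \<in> (\<Union>v\<in>G. {n. v n \<noteq> zer n})}"
    using finite_vimageI[of _ deg] deg_eq_iff unfolding vimage_def inj_def by blast
  then obtain K where K: "{k. deg k \<in> (\<Union>v\<in>G. {n. v n \<noteq> zer n})} \<subseteq> {..<K}"
    using finite_nat_bounded by blast
  have vanish: "v (deg k) = zer (deg k)" if "v \<in> G" "k \<ge> K" for v k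
    using K that by force
  define good where "good k B \<longleftrightarrow> B \<in> Sub (Suc k) \<and> (\<forall>j\<in>J. act d j (deg k) ` P k \<subseteq> B)" for k B
  \<comment> \<open>The elements with the desired property. Being a submodule that contains the
    generators, \<open>T\<close> is all of \<open>lift P\<close>.\<close>
  define T where "T = {v \<in> lift P. \<forall>k\<ge>K. \<forall>B. good k B \<longrightarrow> v (deg (Suc k)) \<in> B}"
  have "hom_submod C Rg phi X Y n0 T"
    unfolding hom_submod_def
  proof (intro conjI ballI allI)
    note L = lift_submod[OF P, unfolded hom_submod_def]
    show "T \<subseteq> Collect (homvec C X Y n0)" using L unfolding T_def by blast
    show "zer \<in> T" using L SubD(3) unfolding T_def good_def by auto
    show "vadd C v w \<in> T" if "v \<in> T" "w \<in> T" for v w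
      using that L SubD(4) unfolding T_def good_def by (auto simp: vadd_def)
    show "hsmult C phi Y m r v \<in> T" if r: "r \<in> Rg m" and v: "v \<in> T" for m r v
    proof -
      have vL: "v \<in> lift P" using v unfolding T_def by blast
      have "hsmult C phi Y m r v (deg (Suc k)) \<in> B" if k: "k \<ge> K" and B: "good k B" for k B
      proof (cases "hsmult C phi Y m r v (deg (Suc k)) = zer (deg (Suc k))")
        case True
        then show ?thesis using SubD(3) B unfolding good_def by simp
      next
        case False
        then obtain q l where q: "m = d * q" "deg (Suc k) = deg (l + q)"
          and eq: "hsmult C phi Y m r v (deg (Suc k)) = act (d * q) r (deg l) (v (deg l))"
          by (rule hsmult_deg[OF vL r])
        have kl: "Suc k = l + q" using q(2) deg_eq_iff by blast
        have B': "B \<in> Sub (Suc k)" "\<And>j. j \<in> J \<Longrightarrow> act d j (deg k) ` P k \<subseteq> B"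
          using B unfolding good_def by auto
        show ?thesis
        \<comment> \<open>For \<open>q = 0\<close> the component is a scalar multiple of one already
          in \<open>B\<close>, as \<open>v\<close> is in \<open>T\<close>. For \<open>q > 0\<close>
          membership of \<open>v\<close> in \<open>lift P\<close> suffices, since a step of degree
          \<open>d\<close> remains.\<close>
        proof (cases q)
          case 0
          then have "v (deg l) \<in> B" using v k B kl unfolding T_def by auto
          then show ?thesis using SubD(5)[OF B'(1), of r "v (deg l)"] r q 0 kl eq by simp
        next
          case (Suc q')
          have "v (deg l) \<in> P l" using vL unfolding lift_def by blast
          then have "act (d * Suc q') r (deg l) (v (deg l)) \<in> B"
            by (intro power_Suc_in[OF P]) (use r q B' kl Suc in auto)
          then show ?thesis using eq Suc by simp
        qed
      qed
      moreover have "hsmult C phi Y m r v \<in> lift P" using L r vL by blast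
      ultimately show ?thesis unfolding T_def by blast
    qed
  qed
  moreover have "G \<subseteq> T"
  proof
    fix v assume v: "v \<in> G"
    have "v (deg (Suc k)) \<in> B" if "k \<ge> K" "good k B" for k B
      using vanish[OF v, of "Suc k"] SubD(3)[of B "Suc k"] that unfolding good_def by simp
    then show "v \<in> T" using v G(2) unfolding T_def by auto
  qed
  ultimately have LT: "lift P \<subseteq> T" using G(3) by blast
  show ?thesis
  proof (intro exI[of _ K] allI impI ballI subsetI)
    fix k B f assume k: "K \<le> k" and B: "B \<in> Sub (Suc k)" "\<forall>j\<in>J. act d j (deg k) ` P k \<subseteq> B"
      and f: "f \<in> P (Suc k)"
    \<comment> \<open>The element \<open>f\<close> placed in a single degree;
      \<open>b \<ge> n0\<close> ensures that this degree is not truncated away.\<close>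
    define v where "v = (\<lambda>n. if n = deg (Suc k) then f else zer n)"
    have "{n. v n \<noteq> zer n} \<subseteq> {deg (Suc k)}" unfolding v_def by auto
    then have "finite {n. v n \<noteq> zer n}" using finite_subset by blast
    moreover have "\<not> deg (Suc k) < n0" 
    proof -
      have "0 \<le> int d * int (Suc k)" by (intro mult_nonneg_nonneg) auto
      then show ?thesis using b unfolding deg_def by linarith
    qed
    moreover have "f \<in> H (deg (Suc k))" by (rule SubD(2)[OF P' f])
    ultimately have "homvec C X Y n0 v" unfolding homvec_def using Zer_closed by (auto simp: v_def)
    moreover have "v (deg l) \<in> P l" for l using f SubD(3)[OF P'] deg_eq_iff by (auto simp: v_def)
    ultimately have "v \<in> lift P" unfolding lift_def by (auto simp: v_def)
    then have "v (deg (Suc k)) \<in> B" using LT k B unfolding T_def good_def by blast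
    then show "f \<in> B" by (simp add: v_def)
  qed
qed

sublocale noetherian_sequence "\<lambda>k. H (deg k)" "Add C" "\<lambda>k. zer (deg k)" "Rg 0"
  "\<lambda>a k. act 0 a (deg k)" "- 1" J "\<lambda>j k. act d j (deg k)"
  by unfold_locales (rule finite_chain_lengths_Sub, rule J_finite, rule eventually_generated)

lemma hilbert_polynomial: "eventually_poly (\<lambda>k. of_nat (lam C Rg phi X Y (b + int d * int k)) :: 'f::field_char_0)"
  by (fold deg_def, unfold lam_eq) (rule hilbert_serre)

text \<open>If the module in one degree is zero, then so are its images, and \<open>B = {0}\<close>
  is an admissible test submodule for the next degree.\<close>

lemma lam_vanishing_step:
  "\<exists>K. \<forall>k\<ge>K. lam C Rg phi X Y (b + int d * int k) = 0 \<longrightarrow> lam C Rg phi X Y (b + int d * int (Suc k)) = 0"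
proof -
  have "Graded_Sub (\<lambda>k. H (deg k))" unfolding Graded_Sub_def using M_in_Sub x_closed by auto
  from eventually_generated[OF this] obtain K where K: "\<forall>k\<ge>K. \<forall>B\<in>Sub (Suc k). (\<forall>j\<in>J. act d j (deg k) ` H (deg k) \<subseteq> B) \<longrightarrow> H (deg (Suc k)) \<subseteq> B"
    by (rule exE)
  have "lam C Rg phi X Y (deg (Suc k)) = 0" if k: "k \<ge> K" and 0: "lam C Rg phi X Y (deg k) = 0" for k
  proof -
    have "act d j (deg k) ` H (deg k) \<subseteq> {zer (deg (Suc k))}" if "j \<in> J" for j
      using 0 x_zero[OF that, of k] unfolding lam_eq_0_iff by auto
    then show ?thesis unfolding lam_eq_0_iff
      by (intro K[rule_format, OF k zero_in_Sub])
  qed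
  then show ?thesis unfolding deg_def by (intro exI[of _ K]) simp
qed

end

text \<open>The bound \<open>n0\<close> is uniform in the starting degree \<open>b\<close>, so one
  value serves all residue classes; the thresholds for \<open>k\<close> depend on
  \<open>b\<close>.\<close>

lemma noeth_fl_lam:
  assumes "standing_ring Rg d" "is_triangulated C" "r_linear C Rg phi" "noeth_fl C Rg phi X Y"
  shows "\<exists>n0. \<forall>b\<ge>n0. eventually_poly (\<lambda>k. of_nat (lam C Rg phi X Y (b + int d * int k)) :: 'f::field_char_0) \<and>
    (\<exists>K. \<forall>k\<ge>K. lam C Rg phi X Y (b + int d * int k) = 0 \<longrightarrow>
       lam C Rg phi X Y (b + int d * int (Suc k)) = 0)"
proof -
  interpret linear_triangulated C Rg phi d X Y
    using assms by unfold_locales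
  obtain n0 where n0: "noeth_from C Rg phi X Y n0" using assms(4) unfolding noeth_fl_def by blast
  obtain J where J: "finite J" "J \<subseteq> Rg d" "\<forall>r\<in>Rg d. \<exists>c. (\<forall>a. c a \<in> Rg 0) \<and> r = (\<Sum>a\<in>J. c a * a)"
    using finitely_many_generators[OF graded ring_noetherian, of d] by (elim exE conjE) (rule that)
  have loc: "noetherian_hom C Rg phi d X Y n0 b J" if "b \<ge> n0" for b
    using that n0 J(1,2) J(3)[rule_format] assms(4)
    by unfold_locales (simp_all only: noeth_fl_def)
  show ?thesis
    by (intro exI[of _ n0] allI impI conjI; rule noetherian_hom.hilbert_polynomial[OF loc]
        noetherian_hom.lam_vanishing_step[OF loc])
qed

section \<open>Iterated differences and vanishing\<close>

text \<open>A bound by the leading coefficient itself, stronger than positivity, makes the induction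
  pass: in a + k p(k) the term k p(k) is at least k times that coefficient and outgrows
  \<open>a\<close>.\<close>

lemma lead_coeff_pos_eventually_pos:
  fixes p :: "'a::archimedean_field poly"
  assumes "lead_coeff p > 0"
  shows "\<forall>\<^sub>F k in sequentially. poly p (of_nat k) \<ge> lead_coeff p"
  using assms
proof (induction p)
  case (pCons a p)
  show ?case
  proof (cases "p = 0")
    case False
    then have pos: "lead_coeff p > 0" using pCons by simp
    obtain K where K: "lead_coeff p - a < of_nat K * lead_coeff p"
      using ex_less_of_nat_mult[OF pos] by blast
    have "\<forall>\<^sub>F k in sequentially. k \<ge> K" by (rule eventually_ge_at_top)
    with pCons.IH[OF pos] show ?thesis
    proof eventually_elim
      case (elim k)
      have "of_nat K * lead_coeff p \<le> of_nat k * lead_coeff p"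
        using elim(2) pos by (intro mult_right_mono) auto
      then have "lead_coeff p \<le> a + of_nat k * lead_coeff p" using K by (simp add: algebra_simps)
      also have "\<dots> \<le> a + of_nat k * poly p (of_nat k)" using elim(1) by (simp add: mult_left_mono)
      finally show ?case using False by simp
    qed
  qed simp
qed simp

text \<open>A negative coefficient at the degree bound would be the leading one, and -p would
  eventually be positive. The bound \<open>m\<close> is free because polynomials of different
  degrees are later compared at one exponent.\<close>

lemma coeff_nonneg_of_eventually_nonneg:
  fixes p :: "'a::archimedean_field poly"
  assumes "\<forall>\<^sub>F k in sequentially. poly p (of_nat k) \<ge> 0" and "degree p \<le> m"
  shows "coeff p m \<ge> 0"
proof (rule ccontr)
  assume "\<not> coeff p m \<ge> 0"
  then have m: "m = degree p" "lead_coeff (- p) > 0"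
    using assms(2) coeff_eq_0[of p m] by (cases "degree p < m"; force)+
  have "\<forall>\<^sub>F k in sequentially. False"
    using lead_coeff_pos_eventually_pos[OF m(2)] assms(1)
    by eventually_elim (use m(2) in simp)
  then show False by simp
qed

section \<open>Iterated differences with step d\<close>

lemma Delta_diff: "Delta d (\<lambda>n. f n - g n) = (\<lambda>n. Delta d f n - Delta d g n)"
  by (simp add: Delta_def fun_eq_iff)

lemma Delta_funpow_diff:
  "(Delta d ^^ m) (\<lambda>n. f n - g n) = (\<lambda>n. (Delta d ^^ m) f n - (Delta d ^^ m) g n)"
  by (induction m arbitrary: f g) (simp_all add: Delta_diff funpow_Suc_right del: funpow.simps)

lemma Delta_funpow_shift: "(Delta d ^^ m) (\<lambda>n. f (n + a)) = (\<lambda>n. (Delta d ^^ m) f (n + a))"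
proof (induction m arbitrary: f)
  case (Suc m)
  have "Delta d (\<lambda>n. f (n + a)) = (\<lambda>n. Delta d f (n + a))"
    by (simp add: Delta_def fun_eq_iff algebra_simps)
  then show ?case using Suc by (simp add: funpow_Suc_right del: funpow.simps)
qed simp

text \<open>Along a progression of step \<open>d\<close>, \<open>Delta d\<close> is the ordinary
  forward difference of the polynomial, and each application multiplies the top coefficient by the
  current degree bound.\<close>

lemma Delta_funpow_poly:
  fixes p :: "'a::field_char_0 poly"
  assumes "\<And>k. k \<ge> K \<Longrightarrow> of_int (f (a + int d * int k)) = poly p (of_nat k)" and "degree p \<le> m" and "k \<ge> K"
  shows "of_int ((Delta d ^^ m) f (a + int d * int k)) = fact m * coeff p m"
  using assms
proof (induction m arbitrary: f p)
  case 0
  then obtain c where "p = [:c:]" by (auto elim: degree_eq_zeroE)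
  with 0 show ?case by simp
next
  case (Suc m)
  have sd: "degree (shift_diff p) \<le> m" "coeff (shift_diff p) m = of_nat (Suc m) * coeff p (Suc m)"
    using shift_diff_degree[OF Suc.prems(2)] by auto
  have "of_int ((Delta d ^^ m) (Delta d f) (a + int d * int k)) = fact m * coeff (shift_diff p) m"
  proof (rule Suc.IH[OF _ sd(1) Suc.prems(3)])
    fix k assume k: "k \<ge> K"
    have "a + int d * int k + int d = a + int d * int (Suc k)" by (simp add: algebra_simps)
    then show "of_int (Delta d f (a + int d * int k)) = poly (shift_diff p) (of_nat k)"
      using Suc.prems(1)[OF k] Suc.prems(1)[of "Suc k"] k
      unfolding Delta_def of_int_diff poly_shift_diff by (simp only: le_SucI of_nat_Suc add.commute)
  qed
  then show ?case unfolding sd(2) by (simp add: funpow_Suc_right algebra_simps del: funpow.simps)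
qed

text \<open>There are finitely many classes, so the largest of their thresholds works for all of
  them.\<close>

lemma eventually_residues:
  fixes d :: nat and Q :: "int \<Rightarrow> bool"
  assumes "d > 0" and "\<And>i. i < d \<Longrightarrow> \<exists>K. \<forall>k\<ge>K. Q (a + int i + int d * int k)"
  shows "\<exists>N. \<forall>n\<ge>N. Q n"
proof -
  obtain K where K: "\<And>i k. i < d \<Longrightarrow> k \<ge> K i \<Longrightarrow> Q (a + int i + int d * int k)"
    using assms(2) by metis
  define M where "M = Max (K ` {..<d})"
  have M: "K i \<le> M" if "i < d" for i unfolding M_def using that by auto
  show ?thesis
  proof (intro exI[of _ "a + int d * int M"] allI impI)
    fix n assume n: "n \<ge> a + int d * int M"
    define i k where "i = nat ((n - a) mod int d)" and "k = nat ((n - a) div int d)"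
    have d0: "int d > 0" using assms(1) by simp
    have "0 \<le> int d * int M" by simp
    then have "n - a \<ge> 0" using n by linarith
    then have ik: "int i = (n - a) mod int d" "int k = (n - a) div int d"
      unfolding i_def k_def using d0 by (simp_all add: pos_imp_zdiv_nonneg_iff)
    then have i: "i < d" using d0 by (metis of_nat_less_iff pos_mod_bound)
    have "int M \<le> int k"
      using zdiv_mono1[of "int d * int M" "n - a" "int d"] n d0 ik by simp
    moreover have "n = a + int i + int d * int k" unfolding ik by (simp add: algebra_simps)
    ultimately show "Q n" using K[OF i, of k] M[OF i] by simp
  qed
qed

theorem theorem6p11:
  fixes C :: "('o,'m) tcat" and Rg :: "nat \<Rightarrow> 'r::comm_ring_1 set"
    and phi :: "nat \<Rightarrow> 'r \<Rightarrow> 'o \<Rightarrow> 'm" and d s :: nat and X Y :: 'o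
  assumes "standing_ring Rg d"
    and "is_triangulated C"
    and "r_linear C Rg phi"
    and "noeth_fl C Rg phi X Y"
    and "s = cx C Rg phi d X Y"
    and "s = 0 \<longrightarrow> (\<forall>\<^sub>F n in at_bot. lam C Rg phi X Y n = 0)"
    and "emult C Rg phi d X Y s = 0"
  shows "\<exists>m0::int. \<forall>k\<ge>m0. (\<forall>j<d div 2. lam C Rg phi X Y (k + 2 * int j) = 0) \<longrightarrow>
            (\<forall>n\<ge>m0. lam C Rg phi X Y n = 0)"
proof -
  define l where "l = lam C Rg phi X Y"
  define g where "g = hilb_poly C Rg phi d X Y"
  have d: "even d" "d > 0" using assms(1) unfolding standing_ring_def by auto
  have "\<exists>n0. \<forall>b\<ge>n0. eventually_poly (\<lambda>k. rat_of_nat (l (b + int d * int k))) \<and>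
      (\<exists>K. \<forall>k\<ge>K. l (b + int d * int k) = 0 \<longrightarrow> l (b + int d * int (Suc k)) = 0)"
    unfolding l_def by (rule noeth_fl_lam[OF assms(1-4)])
  then obtain n0 where
    poly: "\<And>b. b \<ge> n0 \<Longrightarrow> eventually_poly (\<lambda>k. rat_of_nat (l (b + int d * int k)))" and
    step: "\<And>b. b \<ge> n0 \<Longrightarrow> \<exists>K. \<forall>k\<ge>K. l (b + int d * int k) = 0 \<longrightarrow> l (b + int d * int (Suc k)) = 0"
    by blast
  have g_ev: "\<forall>\<^sub>F k in sequentially. poly (g i) (of_nat k) = of_nat (l (int d * int k + int i))" for i
  proof -
    \<comment> \<open>\<open>hilb_poly\<close> counts from degree \<open>i\<close>, which may lie
      below \<open>n0\<close>. Since \<open>d \<ge> 1\<close>, skipping \<open>m\<close> periods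
      reaches \<open>n0\<close>, and an offset does not affect being eventually polynomial.\<close>
    define m where "m = nat n0"
    have "int d * int m \<ge> 1 * int m" using d by (intro mult_right_mono) auto
    then have "int i + int d * int m \<ge> n0" unfolding m_def by linarith
    from poly[OF this] have "eventually_poly (\<lambda>k. of_nat (l (int d * int (k + m) + int i)) :: rat)"
      by (simp add: algebra_simps)
    then have "eventually_poly (\<lambda>k. of_nat (l (int d * int k + int i)) :: rat)"
      by (subst (asm) eventually_poly_offset[of "\<lambda>k. of_nat (l (int d * int k + int i))"])
    then obtain p :: "rat poly" where p: "\<forall>\<^sub>F k in sequentially. poly p (of_nat k) = of_nat (l (int d * int k + int i))"
      unfolding eventually_poly_def by blast
    have "g i = p" unfolding g_def hilb_poly_def l_def[symmetric]
    proof (rule the_equality)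
      show "\<forall>\<^sub>F k in sequentially. poly p (of_nat k) = of_nat (l (int d * int k + int i))" by (rule p)
      fix q :: "rat poly"
      assume "\<forall>\<^sub>F k in sequentially. poly q (of_nat k) = of_nat (l (int d * int k + int i))"
      with p have "\<forall>\<^sub>F k in sequentially. poly q (of_nat k) = poly p (of_nat k)"
        by eventually_elim simp
      then show "q = p" by (rule eventually_poly_unique)
    qed
    with p show ?thesis by simp
  qed
  have g_K: "\<exists>K. \<forall>k\<ge>K. poly (g i) (of_nat k) = of_nat (l (int i + int d * int k))" for i
    using g_ev[of i] unfolding eventually_sequentially by (simp add: add.commute)
  let ?c = "\<lambda>i. if g i = 0 then 0 else Suc (degree (g i))"
  have s: "s = Max (?c ` {..<d})" unfolding assms(5) cx_def g_def ..
  have c_le: "?c i \<le> s" if "i < d" for i unfolding s by (rule Max_ge) (use that in auto)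
  have "s \<in> ?c ` {..<d}" unfolding s by (rule Max_in) (use d in auto)
  then obtain i0 where i0: "i0 < d" "s = ?c i0" by auto
  show ?thesis
  proof (cases "s = 0")
    case True
    have "\<exists>N. \<forall>n\<ge>N. l n = 0"
    proof (rule eventually_residues[OF d(2), where a = 0])
      fix i assume i: "i < d"
      then have "g i = 0" using c_le[OF i] True by (auto split: if_splits)
      then show "\<exists>K. \<forall>k\<ge>K. l (0 + int i + int d * int k) = 0" using g_K[of i] by simp
    qed
    then show ?thesis unfolding l_def by blast
  next
    case False
    \<comment> \<open>The common bound for the degrees of all \<open>g i\<close>, attained at
      \<open>i0\<close>, and also the number of differences in \<open>emult\<close>.\<close>
    define m where "m = s - 1"
    have s_m: "s = Suc m" using False by (simp add: m_def)
    have deg: "degree (g i) \<le> m" if "i < d" for i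
      using c_le[OF that] s_m by (auto split: if_splits)
    have lead: "coeff (g i0) m \<noteq> 0" using i0(2) s_m by (auto split: if_splits)
    have nonneg: "coeff (g i) m \<ge> 0" if "i < d" for i
    proof (rule coeff_nonneg_of_eventually_nonneg[OF _ deg[OF that]])
      show "\<forall>\<^sub>F k in sequentially. poly (g i) (of_nat k) \<ge> 0"
        using g_ev[of i] by eventually_elim simp
    qed
    define sg :: "int \<Rightarrow> int" where "sg n = (if even n then 1 else - 1)" for n
    define mu where "mu n = sg n * int (l n)" for n
    define h where "h = hfun C Rg phi d X Y"
    define D where "D = (Delta d ^^ m) h"
    have h: "h n = (\<Sum>i<d. mu (n + int i))" for n
      unfolding h_def hfun_def mu_def l_def sg_def ..
    have sg_d: "sg (int i + int d * int k) = sg (int i)" for i k using d by (simp add: sg_def)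
    have mu_g: "\<exists>K. \<forall>k\<ge>K. of_int (mu (int i + int d * int k)) = poly (smult (of_int (sg (int i))) (g i)) (of_nat k)" for i
      using g_K[of i] unfolding mu_def sg_d by fastforce
    \<comment> \<open>\<open>h\<close> sums \<open>mu\<close> over a window of length
      \<open>d\<close>; moving the window by one exchanges only the two end terms.\<close>
    have "h (n + 1) - h n = Delta d mu n" for n
    proof -
      have "h (n + 1) = (\<Sum>i<d. mu (n + int (Suc i)))" unfolding h by (simp add: algebra_simps)
      then have "mu n + h (n + 1) = h n + mu (n + int d)"
        unfolding h using sum.lessThan_Suc_shift[of "\<lambda>i. mu (n + int i)" d]
          sum.lessThan_Suc[of "\<lambda>i. mu (n + int i)" d] by simp
      then show ?thesis by (simp add: Delta_def)
    qed
    then have D_step: "D (n + 1) - D n = (Delta d ^^ s) mu n" for n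
      using Delta_funpow_diff[of m d "\<lambda>n. h (n + 1)" h] Delta_funpow_shift[of m d h 1]
      unfolding D_def s_m by (simp add: funpow_Suc_right del: funpow.simps)
    \<comment> \<open>On each class \<open>mu\<close> is eventually a polynomial of degree below
      \<open>s\<close>, which \<open>s\<close> differences annihilate. All classes together make
      \<open>D\<close> constant along all large integers, as the limit in \<open>emult\<close>
      requires.\<close>
    have "\<exists>N. \<forall>n\<ge>N. (Delta d ^^ s) mu n = 0"
    proof (rule eventually_residues[OF d(2), where a = 0])
      fix i assume i: "i < d"
      obtain K where K: "\<And>k. k \<ge> K \<Longrightarrow>
        of_int (mu (int i + int d * int k)) = poly (smult (of_int (sg (int i))) (g i)) (of_nat k)"
        using mu_g[of i] by blast
      have dg: "degree (smult (of_int (sg (int i))) (g i)) < s"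
        using deg[OF i] degree_smult_le[of "of_int (sg (int i))" "g i"] s_m by linarith
      have "rat_of_int ((Delta d ^^ s) mu (int i + int d * int k)) = 0" if "k \<ge> K" for k
      proof -
        have "rat_of_int ((Delta d ^^ s) mu (int i + int d * int k)) =
            fact s * coeff (smult (of_int (sg (int i))) (g i)) s"
          by (rule Delta_funpow_poly[OF K less_imp_le[OF dg] that])
        also have "\<dots> = 0" unfolding coeff_eq_0[OF dg] by simp
        finally show ?thesis .
      qed
      then show "\<exists>K. \<forall>k\<ge>K. (Delta d ^^ s) mu (0 + int i + int d * int k) = 0" by auto
    qed
    then obtain N where "\<And>n. n \<ge> N \<Longrightarrow> (Delta d ^^ s) mu n = 0" by blast
    then have N: "D (n + 1) = D n" if "n \<ge> N" for n using D_step[of n] that by simp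
    have D_const: "D n = D N" if "n \<ge> N" for n
      using that by (induction n rule: int_ge_induct) (use N in auto)
    have "D N = emult C Rg phi d X Y s"
    proof -
      have ev: "\<forall>\<^sub>F n in at_top. D n = D N"
        using D_const unfolding eventually_at_top_linorder by blast
      have "(THE c. \<forall>\<^sub>F n in at_top. D n = c) = D N"
      proof (rule the_equality)
        show "\<forall>\<^sub>F n in at_top. D n = D N" by (rule ev)
        fix c assume "\<forall>\<^sub>F n in at_top. D n = c"
        with ev have "\<forall>\<^sub>F n :: int in at_top. c = D N" by eventually_elim simp
        then show "c = D N" by simp
      qed
      then show ?thesis unfolding emult_def D_def h_def m_def using False by simp
    qed
    then have D0: "D n = 0" if "n \<ge> N" for n using D_const[OF that] assms(7) by simp
    \<comment> \<open>At n = d k the window in \<open>h\<close> collects each g_i(k) with the sign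
      of i, so \<open>D\<close> at a large multiple of \<open>d\<close> is m! times this
      sum.\<close>
    have alt_sum: "(\<Sum>i<d. of_int (sg (int i)) * coeff (g i) m) = 0"
    proof -
      let ?p = "\<Sum>i<d. smult (of_int (sg (int i))) (g i)"
      obtain K where K: "\<And>i k. k \<ge> K i \<Longrightarrow>
        of_int (mu (int i + int d * int k)) = poly (smult (of_int (sg (int i))) (g i)) (of_nat k)"
        using mu_g by metis
      define L where "L = Max (insert (nat N) (K ` {..<d}))"
      have L: "K i \<le> L" if "i < d" for i unfolding L_def using that by auto
      have "nat N \<le> L" unfolding L_def by simp
      then have "N \<le> 1 * int L" by linarith
      also have "\<dots> \<le> int d * int L" using d by (intro mult_right_mono) auto
      finally have "N \<le> 0 + int d * int L" by simp
      have "rat_of_int (h (0 + int d * int k)) = poly ?p (of_nat k)" if "k \<ge> L" for k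
        unfolding h of_int_sum poly_sum
        by (rule sum.cong[OF refl]) (use K L that in \<open>auto simp: add.commute intro: order.trans\<close>)
      then have "rat_of_int (D (0 + int d * int L)) = fact m * coeff ?p m"
        unfolding D_def
        by (rule Delta_funpow_poly)
          (auto intro!: degree_sum_le order.trans[OF degree_smult_le] deg)
      then show ?thesis using D0[OF \<open>N \<le> 0 + int d * int L\<close>] by (simp add: coeff_sum)
    qed
    have "\<exists>N. \<forall>n\<ge>N. l n = 0 \<longrightarrow> l (n + int d) = 0"
    \<comment> \<open>Starting from \<open>n0\<close> keeps each \<open>n0 + i\<close> in the range
      where \<open>step\<close> applies.\<close>
    proof (rule eventually_residues[OF d(2), where a = n0])
      fix i
      show "\<exists>K. \<forall>k\<ge>K. l (n0 + int i + int d * int k) = 0 \<longrightarrow> l (n0 + int i + int d * int k + int d) = 0"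
        using step[of "n0 + int i"] by (simp add: algebra_simps)
    qed
    then obtain m0 where m0: "\<And>n. n \<ge> m0 \<Longrightarrow> l n = 0 \<Longrightarrow> l (n + int d) = 0" by blast
    have False if k: "k \<ge> m0" and zero: "\<And>j. j < d div 2 \<Longrightarrow> l (k + 2 * int j) = 0" for k
    proof -
      have propagate: "l (n + int d * int q) = 0" if "n \<ge> m0" "l n = 0" for n q
      proof (induction q)
        case (Suc q)
        have "m0 \<le> n + int d * int q" by (rule order.trans[OF that(1)]) simp
        then show ?case using m0[OF _ Suc] by (simp add: algebra_simps)
      qed (use that in simp)
      have g0: "g i = 0" if i: "i < d" and par: "even (int i - k)" for i
      proof -
        \<comment> \<open>\<open>k + r\<close> is the representative of the class of
          \<open>i\<close> in the window from \<open>k\<close> to \<open>k + d - 1\<close>. As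
          \<open>i - k\<close> and \<open>d\<close> are even, so is \<open>r\<close>, and
          \<open>k + r\<close> is one of the degrees assumed to vanish.\<close>
        define r where "r = (int i - k) mod int d"
        define q where "q = (int i - k) div int d"
        have iq: "int i = k + r + int d * q" unfolding r_def q_def by (simp add: algebra_simps)
        have r: "0 \<le> r" "r < int d" unfolding r_def using d by auto
        have "even r" using par d unfolding r_def by (simp add: dvd_mod_iff)
        then obtain c where "r = 2 * c" by (rule evenE)
        then obtain j where j: "r = 2 * int j" using r(1) by (auto elim: nonneg_int_cases)
        have "j < d div 2" using r(2) j d(1) by auto
        then have lr: "l (k + r) = 0" using zero j by simp
        have kr: "k + r \<ge> m0" using k r by simp
        \<comment> \<open>The quotient \<open>q\<close> may be negative; for
          \<open>n \<ge> - q\<close> the degree d n + i lies \<open>q + n \<ge> 0\<close> periods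
          above \<open>k + r\<close>, where \<open>propagate\<close> applies.\<close>
        have "\<forall>\<^sub>F n in sequentially. poly (g i) (of_nat n) = poly 0 (of_nat n)"
          using g_ev[of i] eventually_ge_at_top[of "nat (- q)"]
        proof eventually_elim
          case (elim n)
          have "int (nat (q + int n)) = q + int n" using elim(2) by simp
          then have "int d * int n + int i = k + r + int d * int (nat (q + int n))"
            unfolding iq by (simp add: algebra_simps)
          then have "l (int d * int n + int i) = 0" using propagate[OF kr lr] by presburger
          then show ?case using elim(1) by simp
        qed
        then show ?thesis by (rule eventually_poly_unique)
      qed
      \<comment> \<open>Classes with the parity of \<open>k\<close> contribute 0, so replacing their
        sign is harmless, and every other class has sign \<open>- sg k\<close>. The alternating sum
        becomes a sum of nonnegative terms up to one global sign.\<close>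
      have "of_int (sg (int i)) * coeff (g i) m = - of_int (sg k) * coeff (g i) m" if "i < d" for i
        using g0[OF that] by (auto simp: sg_def)
      then have "(\<Sum>i<d. - of_int (sg k) * coeff (g i) m) = 0" using alt_sum by simp
      then have "(\<Sum>i<d. coeff (g i) m) = 0"
        unfolding sum_distrib_left[symmetric] by (simp add: sg_def split: if_splits)
      then have "coeff (g i0) m = 0" using nonneg i0(1) by (subst (asm) sum_nonneg_eq_0_iff) auto
      then show False using lead by simp
    qed
    then show ?thesis unfolding l_def by blast
  qed
qed

end
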